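(* The homomorphism $\eta:U_q\to\Gamma_q$, $u\mapsto(\alpha(u),\gamma(u))$, is not surjective.
   Context: Let $q$ be transcendental over $\mathbb{Q}$ and $\Bbbk$ a field containing $\mathbb{Q}(q)$. $q$-differential operators: let $S$ be a commutative $\mathbb{Z}$-graded $\Bbbk$-algebra, with bicharacter $\beta(n,m)=q^{nm}$. A $\Bbbk$-linear endomorphism $\varphi$ of $S$ is homogeneous of degree $d$ if $\varphi(S_b)\subseteq S_{b+d}$ for all $b$; $\mathrm{grHom}_\Bbbk(S,S)$ is the set of finite sums of homogeneous endomorphisms, an $S$-bimodule via composition with multiplication operators. For $a\in\mathbb{Z}$ put $\widetilde\sigma_a(\psi)=q^{ad}\psi$ for $\psi$ homogeneous of degree $d$ (extended linearly) and $[\varphi,\psi]_a=\varphi\psi-\widetilde\sigma_a(\psi)\varphi$. $D^0$ is the smallest $S$-sub-bimodule containing all homogeneous $\varphi$ for which some $a\in\mathbb{Z}$ satisfies $[\varphi,s]_a=0$ for all $s\in S$; $D^{l+1}$ is the smallest $S$-sub-bimodule containing all homogeneous $\varphi$ for which some $a$ satisfies $[\varphi,s]_a\in D^l$ for all $s\in S$; the ring of $q$-differential operators on $S$ is $\bigcup_l D^l$. Let $D_q$, $L_q$, $M_q$ be the rings of $q$-differential operators on $\Bbbk[x]$ ($\deg x=1$), on $\Bbbk[y]$ ($\deg y=-1$), and on $\Bbbk[x,x^{-1}]$ ($\deg x^{\pm1}=\pm1$), respectively, with $y$ identified with $x^{-1}$. Operators on $\Bbbk[x]$ and on $\Bbbk[y]$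 extend canonically to $\Bbbk[x,x^{-1}]$, giving injective ring homomorphisms $D_q\to M_q$ and $L_q\to M_q$; on the operators defined below, the extension is given by the same formulas for all $m\in\mathbb{Z}$. Define the ring $\Gamma_q=\ker(D_q\oplus L_q\to M_q,\ (\varphi_1,\varphi_2)\mapsto\varphi_1-\varphi_2)$. $U_q$ is the $\Bbbk$-algebra generated by $E,F,K,K^{-1}$ with relations $KK^{-1}=1=K^{-1}K$, $KEK^{-1}=q^2E$, $KFK^{-1}=q^{-2}F$, $EF-FE=\frac{K-K^{-1}}{q-q^{-1}}$. Let $\sigma(x^m)=q^mx^m$, $\partial^{\beta^2}(x^m)=\frac{q^{2m}-1}{q^2-1}x^{m-1}$, $\sigma_y(y^m)=q^{-m}y^m$, $\partial_y^{\beta^2}(y^m)=\frac{1-q^{-2m}}{1-q^{-2}}y^{m-1}$. There are algebra homomorphisms $\alpha:U_q\to D_q$ and $\gamma:U_q\to L_q$ given by $\alpha(K^{\pm1})=\sigma^{\pm2}$, $\alpha(F)=q^{-1}\sigma^{-2}\partial^{\beta^2}$, $\alpha(E)=-q^2x^2\partial^{\beta^2}$; $\gamma(K^{\pm1})=\sigma_y^{\pm2}$, $\gamma(F)=-q^{-3}\sigma_y^{-2}y^2\partial_y^{\beta^2}$, $\gamma(E)=\partial_y^{\beta^2}$; and $(\alpha(u),\gamma(u))\in\Gamma_q$ for all $u\in U_q$. *)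

theory Defs
  imports
    "HOL-Algebra.Algebraic_Closure_Type"
    "HOL-Algebra.Chinese_Remainder"
    "HOL-Library.Poly_Mapping"
    "HOL-Computational_Algebra.Polynomial"
begin

section \<open>The ring of q-differential operators on a graded commutative algebra\<close>

definition bichar :: "'k::field \<Rightarrow> int \<Rightarrow> int \<Rightarrow> 'k" where
  "bichar q n m = q powi (n * m)"

locale graded_comm_algebra = vector_space scale
  for scale :: "'k::field \<Rightarrow> 's::comm_ring_1 \<Rightarrow> 's" +
  fixes G :: "int \<Rightarrow> 's set"
  assumes scale_mult: "scale c (s * t) = scale c s * t"
    and subspace_G: "subspace (G b)"
    and one_G: "1 \<in> G 0"
    and mult_G: "s \<in> G a \<Longrightarrow> t \<in> G b \<Longrightarrow> s * t \<in> G (a + b)"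
    and direct_G: "\<exists>!f. finite {b. f b \<noteq> 0} \<and> (\<forall>b. f b \<in> G b) \<and> s = (\<Sum>b | f b \<noteq> 0. f b)"
begin

definition homogeneous :: "int \<Rightarrow> ('s \<Rightarrow> 's) \<Rightarrow> bool" where
  "homogeneous d \<phi> \<longleftrightarrow> Vector_Spaces.linear scale scale \<phi> \<and> (\<forall>b. \<phi> ` G b \<subseteq> G (b + d))"

definition hom_decomp :: "(int \<Rightarrow> 's \<Rightarrow> 's) \<Rightarrow> ('s \<Rightarrow> 's) \<Rightarrow> bool" where
  "hom_decomp f \<psi> \<longleftrightarrow> finite {d. f d \<noteq> (\<lambda>_. 0)} \<and> (\<forall>d. homogeneous d (f d)) \<and>
     \<psi> = (\<lambda>s. \<Sum>d | f d \<noteq> (\<lambda>_. 0). f d s)"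

definition grHom :: "('s \<Rightarrow> 's) set" where
  "grHom = {\<psi>. \<exists>f. hom_decomp f \<psi>}"

text \<open>The homogeneous components of an element of \<^const>\<open>grHom\<close>; they are unique because \<open>S\<close>
  is the direct sum of the \<open>G b\<close>.\<close>

definition component :: "('s \<Rightarrow> 's) \<Rightarrow> int \<Rightarrow> 's \<Rightarrow> 's" where
  "component \<psi> = (THE f. hom_decomp f \<psi>)"

definition twist :: "'k \<Rightarrow> int \<Rightarrow> ('s \<Rightarrow> 's) \<Rightarrow> 's \<Rightarrow> 's" where
  "twist q a \<psi> =
     (\<lambda>s. \<Sum>d | component \<psi> d \<noteq> (\<lambda>_. 0). scale (bichar q a d) (component \<psi> d s))"

definition bracket :: "'k \<Rightarrow> int \<Rightarrow> ('s \<Rightarrow> 's) \<Rightarrow> ('s \<Rightarrow> 's) \<Rightarrow> 's \<Rightarrow> 's" where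
  "bracket q a \<phi> \<psi> = (\<lambda>s. \<phi> (\<psi> s) - twist q a \<psi> (\<phi> s))"

definition subbimodule :: "('s \<Rightarrow> 's) set \<Rightarrow> bool" where
  "subbimodule B \<longleftrightarrow> B \<subseteq> grHom \<and> (\<lambda>_. 0) \<in> B \<and>
     (\<forall>\<phi>\<in>B. \<forall>\<psi>\<in>B. (\<lambda>s. \<phi> s + \<psi> s) \<in> B) \<and>
     (\<forall>r. \<forall>\<phi>\<in>B. (*) r \<circ> \<phi> \<in> B \<and> \<phi> \<circ> (*) r \<in> B)"

definition bimodule_gen :: "('s \<Rightarrow> 's) set \<Rightarrow> ('s \<Rightarrow> 's) set" where
  "bimodule_gen A = \<Inter>{B. subbimodule B \<and> A \<subseteq> B}"

primrec diffops_upto :: "'k \<Rightarrow> nat \<Rightarrow> ('s \<Rightarrow> 's) set" where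
  "diffops_upto q 0 = bimodule_gen
     {\<phi>. (\<exists>d. homogeneous d \<phi>) \<and> (\<exists>a. \<forall>s. bracket q a \<phi> ((*) s) = (\<lambda>_. 0))}"
| "diffops_upto q (Suc l) = bimodule_gen
     {\<phi>. (\<exists>d. homogeneous d \<phi>) \<and> (\<exists>a. \<forall>s. bracket q a \<phi> ((*) s) \<in> diffops_upto q l)}"

definition diffops :: "'k \<Rightarrow> ('s \<Rightarrow> 's) ring" where
  "diffops q = \<lparr>carrier = (\<Union>l. diffops_upto q l), monoid.mult = (\<circ>), one = id,
     zero = (\<lambda>_. 0), add = (\<lambda>\<phi> \<psi> s. \<phi> s + \<psi> s)\<rparr>"

end


section \<open>The three graded algebras\<close>

text \<open>Both \<open>k[x]\<close> and \<open>k[y]\<close> are the type \<^typ>\<open>'k poly\<close>, with different gradings. Laurent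
  polynomials are finitely supported functions on the exponents, multiplied by convolution.\<close>

type_synonym 'k laurent = "int \<Rightarrow>\<^sub>0 'k"

definition scale_laurent :: "'k::field \<Rightarrow> 'k laurent \<Rightarrow> 'k laurent" where
  "scale_laurent c f = Poly_Mapping.single 0 c * f"

definition grading_x :: "int \<Rightarrow> 'k::field poly set" where
  "grading_x b = (if b \<ge> 0 then {Polynomial.monom c (nat b) | c. True} else {0})"

definition grading_y :: "int \<Rightarrow> 'k::field poly set" where
  "grading_y b = (if b \<le> 0 then {Polynomial.monom c (nat (- b)) | c. True} else {0})"

definition grading_laurent :: "int \<Rightarrow> 'k::field laurent set" where
  "grading_laurent b = {Poly_Mapping.single b c | c. True}"

definition D_ring :: "'k::field \<Rightarrow> ('k poly \<Rightarrow> 'k poly) ring" where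
  "D_ring q = graded_comm_algebra.diffops smult grading_x q"

definition L_ring :: "'k::field \<Rightarrow> ('k poly \<Rightarrow> 'k poly) ring" where
  "L_ring q = graded_comm_algebra.diffops smult grading_y q"

definition M_ring :: "'k::field \<Rightarrow> ('k laurent \<Rightarrow> 'k laurent) ring" where
  "M_ring q = graded_comm_algebra.diffops scale_laurent grading_laurent q"


section \<open>The ring \<open>\<Gamma>\<^sub>q\<close>\<close>

definition embed_x :: "'k::field poly \<Rightarrow> 'k laurent" where
  "embed_x p = (\<Sum>i\<le>Polynomial.degree p. Poly_Mapping.single (int i) (Polynomial.coeff p i))"

definition embed_y :: "'k::field poly \<Rightarrow> 'k laurent" where
  "embed_y p = (\<Sum>i\<le>Polynomial.degree p. Poly_Mapping.single (- int i) (Polynomial.coeff p i))"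

text \<open>The canonical extension of an operator is the q-differential operator on the Laurent
  polynomials that restricts to it.\<close>

definition extend_x :: "'k::field \<Rightarrow> ('k poly \<Rightarrow> 'k poly) \<Rightarrow> 'k laurent \<Rightarrow> 'k laurent" where
  "extend_x q \<phi> = (THE \<psi>. \<psi> \<in> carrier (M_ring q) \<and> (\<forall>p. \<psi> (embed_x p) = embed_x (\<phi> p)))"

definition extend_y :: "'k::field \<Rightarrow> ('k poly \<Rightarrow> 'k poly) \<Rightarrow> 'k laurent \<Rightarrow> 'k laurent" where
  "extend_y q \<phi> = (THE \<psi>. \<psi> \<in> carrier (M_ring q) \<and> (\<forall>p. \<psi> (embed_y p) = embed_y (\<phi> p)))"

definition Gamma_ring :: "'k::field \<Rightarrow> (('k poly \<Rightarrow> 'k poly) \<times> ('k poly \<Rightarrow> 'k poly)) ring" where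
  "Gamma_ring q = (RDirProd (D_ring q) (L_ring q))
     \<lparr>carrier := a_kernel (RDirProd (D_ring q) (L_ring q)) (M_ring q)
        (\<lambda>(\<phi>\<^sub>1, \<phi>\<^sub>2). extend_x q \<phi>\<^sub>1 \<ominus>\<^bsub>M_ring q\<^esub> extend_y q \<phi>\<^sub>2)\<rparr>"


section \<open>The quantum group \<open>U\<^sub>q\<close>\<close>

instantiation list :: (type) monoid_add
begin

definition zero_list :: "'a list" where
  "zero_list = []"

definition plus_list :: "'a list \<Rightarrow> 'a list \<Rightarrow> 'a list" where
  "plus_list = (@)"

instance
  by standard (simp_all add: zero_list_def plus_list_def)

end

datatype generator = gE | gF | gK | gKinv

text \<open>With words under concatenation as exponents, \<^typ>\<open>generator list \<Rightarrow>\<^sub>0 'k\<close> is the free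
  associative algebra on the generators.\<close>

type_synonym 'k free_algebra = "generator list \<Rightarrow>\<^sub>0 'k"

definition sc :: "'k::field \<Rightarrow> 'k free_algebra" where
  "sc c = Poly_Mapping.single [] c"

definition gen :: "generator \<Rightarrow> 'k::field free_algebra" where
  "gen g = Poly_Mapping.single [g] 1"

definition relators :: "'k::field \<Rightarrow> 'k free_algebra set" where
  "relators q =
    {gen gK * gen gKinv - 1,
     gen gKinv * gen gK - 1,
     gen gK * gen gE * gen gKinv - sc (q ^ 2) * gen gE,
     gen gK * gen gF * gen gKinv - sc (q powi (-2)) * gen gF,
     gen gE * gen gF - gen gF * gen gE
       - sc (1 / (q - inverse q)) * (gen gK - gen gKinv)}"

definition relation_ideal :: "'k::field \<Rightarrow> 'k free_algebra set" where
  "relation_ideal q = genideal ring_of_type_algebra (relators q)"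

definition U_ring :: "'k::field \<Rightarrow> 'k free_algebra set ring" where
  "U_ring q = ring_of_type_algebra Quot relation_ideal q"


section \<open>The homomorphism \<open>\<eta>\<close>\<close>

definition lin_ext :: "(nat \<Rightarrow> 'k::field poly) \<Rightarrow> 'k poly \<Rightarrow> 'k poly" where
  "lin_ext f p = (\<Sum>m\<le>Polynomial.degree p. smult (Polynomial.coeff p m) (f m))"

definition sigma_x :: "'k::field \<Rightarrow> 'k poly \<Rightarrow> 'k poly" where
  "sigma_x q = lin_ext (\<lambda>m. Polynomial.monom (q ^ m) m)"

definition del_x :: "'k::field \<Rightarrow> 'k poly \<Rightarrow> 'k poly" where
  "del_x q = lin_ext (\<lambda>m. Polynomial.monom ((q ^ (2 * m) - 1) / (q ^ 2 - 1)) (m - 1))"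

definition sigma_y :: "'k::field \<Rightarrow> 'k poly \<Rightarrow> 'k poly" where
  "sigma_y q = lin_ext (\<lambda>m. Polynomial.monom (q powi (- int m)) m)"

definition del_y :: "'k::field \<Rightarrow> 'k poly \<Rightarrow> 'k poly" where
  "del_y q = lin_ext (\<lambda>m. Polynomial.monom
     ((1 - q powi (- 2 * int m)) / (1 - q powi (-2))) (m - 1))"

primrec alpha_gen :: "'k::field \<Rightarrow> generator \<Rightarrow> 'k poly \<Rightarrow> 'k poly" where
  "alpha_gen q gK = sigma_x q ^^ 2"
| "alpha_gen q gKinv = inv_into UNIV (sigma_x q) ^^ 2"
| "alpha_gen q gF = smult (inverse q) \<circ> (inv_into UNIV (sigma_x q) ^^ 2) \<circ> del_x q"
| "alpha_gen q gE = smult (- (q ^ 2)) \<circ> (*) (Polynomial.monom 1 2) \<circ> del_x q"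

primrec gamma_gen :: "'k::field \<Rightarrow> generator \<Rightarrow> 'k poly \<Rightarrow> 'k poly" where
  "gamma_gen q gK = sigma_y q ^^ 2"
| "gamma_gen q gKinv = inv_into UNIV (sigma_y q) ^^ 2"
| "gamma_gen q gF = smult (- (q powi (-3))) \<circ> (inv_into UNIV (sigma_y q) ^^ 2) \<circ>
     (*) (Polynomial.monom 1 2) \<circ> del_y q"
| "gamma_gen q gE = del_y q"

text \<open>The algebra homomorphism from the free algebra to the endomorphisms of \<^typ>\<open>'k poly\<close>
  that is determined by the images of the generators.\<close>

definition free_eval ::
  "(generator \<Rightarrow> 'k::field poly \<Rightarrow> 'k poly) \<Rightarrow> 'k free_algebra \<Rightarrow> 'k poly \<Rightarrow> 'k poly" where
  "free_eval \<rho> u =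
     (\<lambda>p. \<Sum>w\<in>Poly_Mapping.keys u. smult (Poly_Mapping.lookup u w) (foldr (\<circ>) (map \<rho> w) id p))"

text \<open>Elements of \<^const>\<open>U_ring\<close> are cosets of the relation ideal, and the evaluation is constant
  on each coset.\<close>

definition alpha :: "'k::field \<Rightarrow> 'k free_algebra set \<Rightarrow> 'k poly \<Rightarrow> 'k poly" where
  "alpha q u = the_elem (free_eval (alpha_gen q) ` u)"

definition gamma :: "'k::field \<Rightarrow> 'k free_algebra set \<Rightarrow> 'k poly \<Rightarrow> 'k poly" where
  "gamma q u = the_elem (free_eval (gamma_gen q) ` u)"

definition eta ::
  "'k::field \<Rightarrow> 'k free_algebra set \<Rightarrow> ('k poly \<Rightarrow> 'k poly) \<times> ('k poly \<Rightarrow> 'k poly)" where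
  "eta q u = (alpha q u, gamma q u)"


section \<open>The three algebras are graded\<close>

lemma lookup_sum_single:
  assumes "finite A" "\<And>b. b \<in> A \<Longrightarrow> f b \<in> grading_laurent b"
  shows "Poly_Mapping.lookup (\<Sum>b\<in>A. f b) n = (if n \<in> A then Poly_Mapping.lookup (f n) n else 0)"
proof -
  have "Poly_Mapping.lookup (\<Sum>b\<in>A. f b) n = (\<Sum>b\<in>A. Poly_Mapping.lookup (f b) n)"
    by (induction A rule: infinite_finite_induct) (auto simp: lookup_add)
  also have "\<dots> = (\<Sum>b\<in>A. if b = n then Poly_Mapping.lookup (f b) n else 0)"
  proof (rule sum.cong)
    fix b assume "b \<in> A"
    then obtain c where "f b = Poly_Mapping.single b c"
      using assms(2) by (auto simp: grading_laurent_def)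
    thus "Poly_Mapping.lookup (f b) n = (if b = n then Poly_Mapping.lookup (f b) n else 0)"
      by (cases "b = n") (simp_all add: lookup_single)
  qed simp
  finally show ?thesis using assms(1) by simp
qed

lemma coeff_sum_monom:
  fixes f :: "int \<Rightarrow> 'k::field poly"
  assumes "finite A" "\<And>b. b \<in> A \<Longrightarrow> f b \<in> grading_x b"
  shows "poly.coeff (\<Sum>b\<in>A. f b) n = (if int n \<in> A then poly.coeff (f (int n)) n else 0)"
proof -
  have "poly.coeff (\<Sum>b\<in>A. f b) n = (\<Sum>b\<in>A. poly.coeff (f b) n)"
    by (simp add: coeff_sum)
  also have "\<dots> = (\<Sum>b\<in>A. if b = int n then poly.coeff (f b) n else 0)"
  proof (rule sum.cong)
    fix b assume "b \<in> A"
    hence "f b \<in> grading_x b" by (rule assms(2))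
    thus "poly.coeff (f b) n = (if b = int n then poly.coeff (f b) n else 0)"
      by (cases "b = int n") (auto simp: grading_x_def split: if_splits)
  qed simp
  finally show ?thesis using assms(1) by simp
qed

lemma direct_x:
  fixes s :: "'k::field poly"
  shows "\<exists>!f. finite {b. f b \<noteq> 0} \<and> (\<forall>b. f b \<in> grading_x b) \<and> s = (\<Sum>b | f b \<noteq> 0. f b)"
proof (rule ex1I[of _ "\<lambda>b. if b \<ge> 0 then Polynomial.monom (poly.coeff s (nat b)) (nat b) else 0"])
  let ?f = "\<lambda>b. if b \<ge> 0 then Polynomial.monom (poly.coeff s (nat b)) (nat b) else 0"
  have "{b. ?f b \<noteq> 0} \<subseteq> int ` {..Polynomial.degree s}"
  proof
    fix b assume "b \<in> {b. ?f b \<noteq> 0}"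
    hence "b \<ge> 0" "poly.coeff s (nat b) \<noteq> 0" by (auto split: if_splits)
    hence "b = int (nat b)" "nat b \<le> Polynomial.degree s" by (auto intro: le_degree)
    thus "b \<in> int ` {..Polynomial.degree s}" by blast
  qed
  hence fin: "finite {b. ?f b \<noteq> 0}" by (rule finite_subset) simp
  moreover have g: "\<forall>b. ?f b \<in> grading_x b" by (auto simp: grading_x_def)
  moreover have "s = (\<Sum>b | ?f b \<noteq> 0. ?f b)"
    by (rule poly_eqI, subst coeff_sum_monom[OF fin]) (use g in auto)
  ultimately show "finite {b. ?f b \<noteq> 0} \<and> (\<forall>b. ?f b \<in> grading_x b) \<and> s = (\<Sum>b | ?f b \<noteq> 0. ?f b)"
    by blast
next
  fix f :: "int \<Rightarrow> 'k poly"
  assume f: "finite {b. f b \<noteq> 0} \<and> (\<forall>b. f b \<in> grading_x b) \<and> s = (\<Sum>b | f b \<noteq> 0. f b)"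
  have c: "poly.coeff s n = poly.coeff (f (int n)) n" for n
    using f coeff_sum_monom[of "{b. f b \<noteq> 0}" f n] by auto
  show "f = (\<lambda>b. if b \<ge> 0 then Polynomial.monom (poly.coeff s (nat b)) (nat b) else 0)"
  proof
    fix b
    have fb: "f b \<in> grading_x b" using f by blast
    show "f b = (if b \<ge> 0 then Polynomial.monom (poly.coeff s (nat b)) (nat b) else 0)"
    proof (cases "b \<ge> 0")
      case True
      with fb obtain k where "f b = Polynomial.monom k (nat b)" by (auto simp: grading_x_def)
      moreover from this have "poly.coeff s (nat b) = k" using c[of "nat b"] True by simp
      ultimately show ?thesis using True by simp
    next
      case False
      with fb show ?thesis by (simp add: grading_x_def)
    qed
  qed
qed

lemma grading_y_x: "grading_y b = grading_x (- b)"
  by (auto simp: grading_y_def grading_x_def)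

lemma direct_y:
  fixes s :: "'k::field poly"
  shows "\<exists>!f. finite {b. f b \<noteq> 0} \<and> (\<forall>b. f b \<in> grading_y b) \<and> s = (\<Sum>b | f b \<noteq> 0. f b)"
    (is "\<exists>!f. ?P f")
proof -
  have flip: "?P f \<longleftrightarrow> finite {b. f (- b) \<noteq> 0} \<and> (\<forall>b. f (- b) \<in> grading_x b) \<and>
      s = (\<Sum>b | f (- b) \<noteq> 0. f (- b))" for f :: "int \<Rightarrow> 'k poly"
  proof -
    have im: "{b. f (- b) \<noteq> 0} = uminus ` {b. f b \<noteq> 0}"
    proof (intro equalityI subsetI)
      fix b assume "b \<in> {b. f (- b) \<noteq> 0}"
      thus "b \<in> uminus ` {b. f b \<noteq> 0}" by (intro image_eqI[of _ _ "- b"]) auto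
    qed auto
    have "finite {b. f (- b) \<noteq> 0} \<longleftrightarrow> finite {b. f b \<noteq> 0}"
      unfolding im by (intro finite_image_iff) (auto simp: inj_on_def)
    moreover have "(\<Sum>b | f (- b) \<noteq> 0. f (- b)) = (\<Sum>b | f b \<noteq> 0. f b)"
      unfolding im by (subst sum.reindex) (auto simp: inj_on_def)
    moreover have "(\<forall>b. f (- b) \<in> grading_x b) \<longleftrightarrow> (\<forall>b. f b \<in> grading_y b)"
      unfolding grading_y_x by (metis minus_minus)
    ultimately show ?thesis by simp
  qed
  from direct_x[of s] obtain g where g:
    "finite {b. g b \<noteq> 0} \<and> (\<forall>b. g b \<in> grading_x b) \<and> s = (\<Sum>b | g b \<noteq> 0. g b)" by blast
  show ?thesis
  proof (rule ex1I[of _ "\<lambda>b. g (- b)"])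
    show "?P (\<lambda>b. g (- b))" by (subst flip) (use g in simp)
    fix f assume "?P f"
    hence "finite {b. f (- b) \<noteq> 0} \<and> (\<forall>b. f (- b) \<in> grading_x b) \<and>
      s = (\<Sum>b | f (- b) \<noteq> 0. f (- b))" using flip[of f] by blast
    from the1_equality[OF direct_x[of s], of "\<lambda>b. f (- b)", OF this]
      the1_equality[OF direct_x[of s], of g, OF g]
    have "(\<lambda>b. f (- b)) = g" by (rule trans[OF sym])
    thus "f = (\<lambda>b. g (- b))" by force
  qed
qed

lemma direct_laurent:
  fixes s :: "'k::field laurent"
  shows "\<exists>!f. finite {b. f b \<noteq> 0} \<and> (\<forall>b. f b \<in> grading_laurent b) \<and> s = (\<Sum>b | f b \<noteq> 0. f b)"
proof (rule ex1I[of _ "\<lambda>b. Poly_Mapping.single b (Poly_Mapping.lookup s b)"])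
  let ?f = "\<lambda>b. Poly_Mapping.single b (Poly_Mapping.lookup s b)"
  have "{b. ?f b \<noteq> 0} = Poly_Mapping.keys s" by (auto simp: in_keys_iff)
       (metis lookup_single_eq lookup_zero)
  hence fin: "finite {b. ?f b \<noteq> 0}" by simp
  moreover have g: "\<forall>b. ?f b \<in> grading_laurent b" by (auto simp: grading_laurent_def)
  moreover have "s = (\<Sum>b | ?f b \<noteq> 0. ?f b)"
  proof (rule poly_mapping_eqI)
    fix n
    have "Poly_Mapping.lookup s n = 0" if "?f n = 0"
      using that by (metis lookup_single_eq lookup_zero)
    thus "Poly_Mapping.lookup s n = Poly_Mapping.lookup (\<Sum>b | ?f b \<noteq> 0. ?f b) n"
      using g by (subst lookup_sum_single[OF fin]) auto
  qed
  ultimately show "finite {b. ?f b \<noteq> 0} \<and> (\<forall>b. ?f b \<in> grading_laurent b) \<and> s = (\<Sum>b | ?f b \<noteq> 0. ?f b)"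
    by blast
next
  fix f :: "int \<Rightarrow> 'k laurent"
  assume f: "finite {b. f b \<noteq> 0} \<and> (\<forall>b. f b \<in> grading_laurent b) \<and> s = (\<Sum>b | f b \<noteq> 0. f b)"
  have c: "Poly_Mapping.lookup s n = Poly_Mapping.lookup (f n) n" for n
    using f lookup_sum_single[of "{b. f b \<noteq> 0}" f n] by auto
  show "f = (\<lambda>b. Poly_Mapping.single b (Poly_Mapping.lookup s b))"
  proof
    fix b
    have "f b \<in> grading_laurent b" using f by blast
    then obtain k where "f b = Poly_Mapping.single b k"
      by (auto simp: grading_laurent_def)
    thus "f b = Poly_Mapping.single b (Poly_Mapping.lookup s b)"
      unfolding c by simp
  qed
qed


lemma vector_space_poly: "vector_space (smult :: 'k::field \<Rightarrow> 'k poly \<Rightarrow> 'k poly)"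
  by unfold_locales (auto simp: smult_add_right smult_add_left)

lemma vector_space_laurent:
  "vector_space (scale_laurent :: 'k::field \<Rightarrow> 'k laurent \<Rightarrow> 'k laurent)"
  unfolding vector_space_def
proof (intro conjI allI)
  fix a b :: 'k and x y :: "'k laurent"
  show "scale_laurent a (x + y) = scale_laurent a x + scale_laurent a y"
    by (simp add: scale_laurent_def distrib_left)
  show "scale_laurent (a + b) x = scale_laurent a x + scale_laurent b x"
    by (simp add: scale_laurent_def single_add distrib_right)
  show "scale_laurent a (scale_laurent b x) = scale_laurent (a * b) x"
    by (simp add: scale_laurent_def mult_single flip: mult.assoc)
  show "scale_laurent 1 x = x"
    by (simp add: scale_laurent_def)
qed

lemma laurent_closed:
  "0 \<in> grading_laurent b"
  "x \<in> grading_laurent b \<Longrightarrow> y \<in> grading_laurent b \<Longrightarrow> x + y \<in> grading_laurent b"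
  "x \<in> grading_laurent b \<Longrightarrow> scale_laurent c x \<in> grading_laurent b"
  unfolding grading_laurent_def
proof -
  show "0 \<in> {Poly_Mapping.single b c | c. True}"
    by (rule CollectI, rule exI[of _ 0]) simp
qed (auto simp: scale_laurent_def mult_single simp flip: single_add)

lemma graded_x: "graded_comm_algebra (smult :: 'k::field \<Rightarrow> 'k poly \<Rightarrow> 'k poly) grading_x"
proof -
  interpret vector_space "smult :: 'k::field \<Rightarrow> 'k poly \<Rightarrow> 'k poly" by (rule vector_space_poly)
  show "graded_comm_algebra (smult :: 'k \<Rightarrow> 'k poly \<Rightarrow> 'k poly) grading_x"
  proof unfold_locales
    show "s * t \<in> grading_x (a + b)" if "s \<in> grading_x a" "t \<in> grading_x b"
      for a b and s t :: "'k poly"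
      using that by (auto simp: grading_x_def mult_monom nat_add_distrib split: if_splits)
    show "subspace (grading_x b)" for b :: int
      by (auto simp: subspace_def grading_x_def add_monom smult_monom intro: exI[of _ 0])
    show "(1 :: 'k poly) \<in> grading_x 0"
      unfolding grading_x_def by (auto intro!: exI[of _ 1])
  qed (auto simp: direct_x)
qed

lemma graded_y: "graded_comm_algebra (smult :: 'k::field \<Rightarrow> 'k poly \<Rightarrow> 'k poly) grading_y"
proof -
  interpret kx: graded_comm_algebra "smult :: 'k \<Rightarrow> 'k poly \<Rightarrow> 'k poly" grading_x
    by (rule graded_x)
  show "graded_comm_algebra (smult :: 'k \<Rightarrow> 'k poly \<Rightarrow> 'k poly) grading_y"
  proof unfold_locales
    show "s * t \<in> grading_y (a + b)" if "s \<in> grading_y a" "t \<in> grading_y b"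
      for a b and s t :: "'k poly"
      using kx.mult_G[of s "- a" t "- b"] that by (simp add: grading_y_x)
    show "kx.subspace (grading_y b)" for b :: int
      by (simp add: grading_y_x kx.subspace_G)
    show "(1 :: 'k poly) \<in> grading_y 0"
      by (simp add: grading_y_x kx.one_G)
    show "\<exists>!f. finite {b. f b \<noteq> 0} \<and> (\<forall>b. f b \<in> grading_y b) \<and> s = (\<Sum>b | f b \<noteq> 0. f b)"
      for s :: "'k poly" by (rule direct_y)
  qed simp
qed

lemma graded_laurent:
  "graded_comm_algebra (scale_laurent :: 'k::field \<Rightarrow> 'k laurent \<Rightarrow> 'k laurent) grading_laurent"
proof -
  interpret vector_space "scale_laurent :: 'k::field \<Rightarrow> 'k laurent \<Rightarrow> 'k laurent"
    by (rule vector_space_laurent)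
  show "graded_comm_algebra (scale_laurent :: 'k \<Rightarrow> 'k laurent \<Rightarrow> 'k laurent) grading_laurent"
  proof unfold_locales
    show "subspace (grading_laurent b)" for b :: int
      unfolding subspace_def by (auto intro: laurent_closed)
    show "(1 :: 'k laurent) \<in> grading_laurent 0"
      unfolding grading_laurent_def by (rule CollectI, rule exI[of _ 1]) simp
    show "\<exists>!f. finite {b. f b \<noteq> 0} \<and> (\<forall>b. f b \<in> grading_laurent b) \<and> s = (\<Sum>b | f b \<noteq> 0. f b)"
      for s :: "'k laurent" by (rule direct_laurent)
    show "s * t \<in> grading_laurent (a + b)" if "s \<in> grading_laurent a" "t \<in> grading_laurent b"
      for a b and s t :: "'k laurent"
      using that by (auto simp: grading_laurent_def mult_single)
  qed (simp add: scale_laurent_def mult.assoc)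
qed


section \<open>\<open>alpha\<close> and \<open>gamma\<close> are well defined\<close>

definition plin :: "('k::field poly \<Rightarrow> 'k poly) \<Rightarrow> bool" where
  "plin f \<longleftrightarrow> (\<forall>p r. f (p + r) = f p + f r) \<and> (\<forall>c p. f (smult c p) = smult c (f p))"

definition wev where "wev \<rho> w = foldr (\<circ>) (map \<rho> w) id"

lemma wev_append: "wev \<rho> (v @ w) = wev \<rho> v \<circ> wev \<rho> w"
  by (induction v) (auto simp: wev_def)

lemma plin_wev: "(\<And>g. plin (\<rho> g)) \<Longrightarrow> plin (wev \<rho> w)"
  by (induction w) (auto simp: wev_def plin_def)

lemma plin_sum: "plin f \<Longrightarrow> f (\<Sum>a\<in>A. g a) = (\<Sum>a\<in>A. f (g a))"
proof (induction A rule: infinite_finite_induct)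
  case empty
  have "f (smult 0 0) = smult 0 (f 0)" using empty unfolding plin_def by blast
  thus ?case by simp
next
  case (infinite A)
  have "f (smult 0 0) = smult 0 (f 0)" using infinite unfolding plin_def by blast
  with infinite show ?case by simp
qed (auto simp: plin_def)

lemma free_eval_super:
  assumes "finite A" "Poly_Mapping.keys u \<subseteq> A"
  shows "free_eval \<rho> u p = (\<Sum>w\<in>A. smult (Poly_Mapping.lookup u w) (wev \<rho> w p))"
  unfolding free_eval_def wev_def using assms
  by (intro sum.mono_neutral_left) (auto simp: in_keys_iff)

lemma free_eval_add: "free_eval \<rho> (u + v) p = free_eval \<rho> u p + free_eval \<rho> v p"
proof -
  let ?A = "Poly_Mapping.keys u \<union> Poly_Mapping.keys v"
  have s: "finite ?A" "Poly_Mapping.keys (u + v) \<subseteq> ?A" by (auto simp: Poly_Mapping.keys_add)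
  show ?thesis
    by (subst (1 2 3) free_eval_super[of ?A])
       (use s in \<open>auto simp: lookup_add smult_add_left sum.distrib\<close>)
qed

lemma free_eval_uminus: "free_eval \<rho> (- u) p = - free_eval \<rho> u p"
  by (simp add: free_eval_def sum_negf)

lemma free_eval_diff: "free_eval \<rho> (u - v) p = free_eval \<rho> u p - free_eval \<rho> v p"
  using free_eval_add[of \<rho> u "- v" p] by (simp add: free_eval_uminus)

lemma free_eval_0: "free_eval \<rho> 0 = (\<lambda>_. 0)"
  by (simp add: free_eval_def)

lemma free_eval_sum: "free_eval \<rho> (\<Sum>a\<in>A. g a) p = (\<Sum>a\<in>A. free_eval \<rho> (g a) p)"
  by (induction A rule: infinite_finite_induct) (auto simp: free_eval_0 free_eval_add)

lemma free_eval_single: "free_eval \<rho> (Poly_Mapping.single w c) p = smult c (wev \<rho> w p)"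
  by (subst free_eval_super[of "{w}"]) auto

lemma free_algebra_decomp: "u = (\<Sum>w\<in>Poly_Mapping.keys u. Poly_Mapping.single w (Poly_Mapping.lookup u w))"
proof (rule poly_mapping_eqI)
  fix n
  have "Poly_Mapping.lookup (\<Sum>w\<in>A. Poly_Mapping.single w (Poly_Mapping.lookup u w)) n
      = (\<Sum>w\<in>A. if w = n then Poly_Mapping.lookup u w else 0)" for A
    by (induction A rule: infinite_finite_induct) (auto simp: lookup_add lookup_single when_def)
  thus "Poly_Mapping.lookup u n = Poly_Mapping.lookup
      (\<Sum>w\<in>Poly_Mapping.keys u. Poly_Mapping.single w (Poly_Mapping.lookup u w)) n"
    by (simp add: in_keys_iff)
qed

lemma smult_sum_right: "smult c (\<Sum>a\<in>A. g a) = (\<Sum>a\<in>A. smult c (g a))"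
  by (induction A rule: infinite_finite_induct) (auto simp: smult_add_right)

lemma free_eval_mult:
  assumes "\<And>g. plin (\<rho> g)"
  shows "free_eval \<rho> (u * v) = free_eval \<rho> u \<circ> free_eval \<rho> v"
proof
  fix p
  let ?s = "\<lambda>u w. Poly_Mapping.single w (Poly_Mapping.lookup u w)"
  have "u * v = (\<Sum>w\<in>Poly_Mapping.keys u. \<Sum>z\<in>Poly_Mapping.keys v. ?s u w * ?s v z)"
    by (subst (1) free_algebra_decomp[of u], subst (1) free_algebra_decomp[of v]) (simp add: sum_product)
  also have "free_eval \<rho> \<dots> p = (\<Sum>w\<in>Poly_Mapping.keys u. \<Sum>z\<in>Poly_Mapping.keys v.
      smult (Poly_Mapping.lookup u w) (wev \<rho> w (smult (Poly_Mapping.lookup v z) (wev \<rho> z p))))"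
    using plin_wev[of \<rho>, OF assms]
    by (simp add: free_eval_sum mult_single free_eval_single plus_list_def wev_append plin_def)
  also have "\<dots> = free_eval \<rho> u (free_eval \<rho> v p)"
    by (simp add: free_eval_super[OF finite_keys order_refl] plin_sum[OF plin_wev[of \<rho>, OF assms]]
      smult_sum_right)
  finally show "free_eval \<rho> (u * v) p = (free_eval \<rho> u \<circ> free_eval \<rho> v) p" by simp
qed

lemma free_eval_1: "free_eval \<rho> 1 = id"
  using free_eval_single[of \<rho> "[]" 1]
  by (auto simp: wev_def zero_list_def simp flip: single_one)

lemma free_eval_gen: "free_eval \<rho> (gen g) = \<rho> g"
  by (auto simp: gen_def free_eval_single wev_def)

lemma free_eval_sc: "free_eval \<rho> (sc c) = smult c"
  by (auto simp: sc_def free_eval_single wev_def)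

lemma ring_free: "ring (ring_of_type_algebra :: 'k::field free_algebra ring)"
proof -
  have "\<exists>y. x + y = 0" for x :: "'k free_algebra"
    using add.right_inverse by blast
  thus ?thesis
    unfolding ring_of_type_algebra_def using add.right_inverse
    by unfold_locales (auto simp:algebra_simps Units_def)
qed

lemma kernel_ideal:
  fixes \<rho> :: "generator \<Rightarrow> 'k::field poly \<Rightarrow> 'k poly"
  assumes "\<And>g. plin (\<rho> g)"
  shows "ideal {u. free_eval \<rho> u = (\<lambda>_. 0)} ring_of_type_algebra"
proof -
  interpret ring "ring_of_type_algebra :: 'k::field free_algebra ring" by (rule ring_free)
  have z: "free_eval \<rho> u 0 = 0" for u
  proof -
    have "wev \<rho> w (smult 0 0) = smult 0 (wev \<rho> w 0)" for w
      using plin_wev[of \<rho>, OF assms] unfolding plin_def by blast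
    thus ?thesis by (simp add: free_eval_super[OF finite_keys order_refl])
  qed
  have inv: "\<ominus>\<^bsub>ring_of_type_algebra\<^esub> u = - u" for u :: "'k free_algebra"
    by (rule minus_equality) (auto simp: ring_of_type_algebra_def)
  show ?thesis
  proof (rule idealI)
    show "subgroup {u. free_eval \<rho> u = (\<lambda>_. 0)} (add_monoid ring_of_type_algebra)"
    proof (rule add.subgroupI)
      show "\<ominus>\<^bsub>ring_of_type_algebra\<^esub> a \<in> {u. free_eval \<rho> u = (\<lambda>_. 0)}"
        if "a \<in> {u. free_eval \<rho> u = (\<lambda>_. 0)}" for a
        using that by (auto simp: inv free_eval_uminus fun_eq_iff)
    qed (auto simp: ring_of_type_algebra_def free_eval_add fun_eq_iff free_eval_0 intro: exI[of _ 0])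
  qed (auto simp: ring_of_type_algebra_def free_eval_mult[OF assms] fun_eq_iff z ring_free[unfolded ring_of_type_algebra_def])
qed

lemma rel_ideal_sub:
  assumes "\<And>g. plin (\<rho> g)" "\<And>u. u \<in> relators q \<Longrightarrow> free_eval \<rho> u = (\<lambda>_. 0)"
  shows "u \<in> relation_ideal q \<Longrightarrow> free_eval \<rho> u = (\<lambda>_. 0)"
  unfolding relation_ideal_def genideal_def using kernel_ideal[of \<rho>, OF assms(1)] assms(2) by blast

lemma eval_coset:
  assumes "\<And>g. plin (\<rho> g)" "\<And>u. u \<in> relators q \<Longrightarrow> free_eval \<rho> u = (\<lambda>_. 0)"
  shows "free_eval \<rho> ` (relation_ideal q +>\<^bsub>ring_of_type_algebra\<^esub> u) = {free_eval \<rho> u}"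
proof -
  have 0: "0 \<in> relation_ideal q"
    using additive_subgroup.zero_closed[OF ideal.axioms(1)[OF ring.genideal_ideal[OF ring_free]], of "relators q"]
    by (auto simp: relation_ideal_def ring_of_type_algebra_def)
  have "relation_ideal q +>\<^bsub>ring_of_type_algebra\<^esub> u = (\<lambda>i. i + u) ` relation_ideal q"
    by (auto simp: a_r_coset_def r_coset_def ring_of_type_algebra_def)
  moreover have "free_eval \<rho> (i + u) = free_eval \<rho> u" if "i \<in> relation_ideal q" for i
    using rel_ideal_sub[OF assms that] by (auto simp: free_eval_add fun_eq_iff)
  ultimately show ?thesis using 0 by (auto simp: image_image)
qed

lemma plin_lin_ext: "plin (lin_ext (f :: nat \<Rightarrow> 'k::field poly))"
proof -
  have super: "lin_ext f p = (\<Sum>m\<le>N. smult (poly.coeff p m) (f m))" if "Polynomial.degree p \<le> N" for p :: "'k poly" and N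
    unfolding lin_ext_def using that
    by (intro sum.mono_neutral_left) (auto simp: coeff_eq_0)
  show ?thesis unfolding plin_def
  proof safe
    fix p r :: "'k poly"
    let ?N = "max (Polynomial.degree p) (Polynomial.degree r)"
    show "lin_ext f (p + r) = lin_ext f p + lin_ext f r"
      by (subst (1 2 3) super[of _ ?N]) (auto intro: degree_add_le_max simp: smult_add_left sum.distrib)
  next
    fix c :: 'k and p
    show "lin_ext f (smult c p) = smult c (lin_ext f p)"
      by (subst (1 2) super[of _ "Polynomial.degree p"]) (auto simp: degree_smult_le smult_sum_right)
  qed
qed

lemma lin_ext_monom: "lin_ext f (Polynomial.monom c m) = smult c (f m)"
proof (cases "c = 0")
  case False
  thus ?thesis
    by (simp add: lin_ext_def degree_monom_eq if_distrib[of "\<lambda>x. smult x _"] cong: if_cong)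
qed (simp add: lin_ext_def)

lemma plin_eqI:
  fixes f g :: "'k::field poly \<Rightarrow> 'k poly"
  assumes "plin f" "plin g" "\<And>m. f (Polynomial.monom 1 m) = g (Polynomial.monom 1 m)"
  shows "f = g"
proof
  fix p :: "'k poly"
  have "p = (\<Sum>m\<le>Polynomial.degree p. smult (poly.coeff p m) (Polynomial.monom 1 m))"
    by (simp add: smult_monom poly_as_sum_of_monoms)
  hence "f p = f (\<Sum>m\<le>Polynomial.degree p. smult (poly.coeff p m) (Polynomial.monom 1 m))"
    "g p = g (\<Sum>m\<le>Polynomial.degree p. smult (poly.coeff p m) (Polynomial.monom 1 m))" by simp_all
  thus "f p = g p" using assms by (simp add: plin_sum plin_def)
qed

lemma plin_comps: "plin f \<Longrightarrow> plin g \<Longrightarrow> plin (f \<circ> g)" "plin (smult c)" "plin ((*) p)" 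
   "plin f \<Longrightarrow> plin (f ^^ 2)" "plin f \<Longrightarrow> plin g \<Longrightarrow> plin (\<lambda>x. f x - g x)" "plin (\<lambda>x. 0)" "plin id"
  by (auto simp: plin_def smult_add_right algebra_simps smult_diff_right eval_nat_numeral)

lemma inv_lin:
  assumes "\<And>m. c m \<noteq> (0 :: 'k::field)"
  shows "inv_into UNIV (lin_ext (\<lambda>m. Polynomial.monom (c m) m)) =
    lin_ext (\<lambda>m. Polynomial.monom (inverse (c m)) m)" (is "inv_into UNIV ?f = ?g")
proof -
  have "?f \<circ> ?g = id" "?g \<circ> ?f = id"
    by (rule plin_eqI; (intro plin_comps plin_lin_ext | simp add: lin_ext_monom smult_monom assms))+
  thus ?thesis by (metis inv_unique_comp)
qed

lemma transcendental_neq: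
  assumes "\<not> algebraic q"
  shows "n > 0 \<Longrightarrow> q ^ n \<noteq> 1" "q \<noteq> 0"
proof -
  show "q ^ n \<noteq> 1" if "n > 0"
  proof
    assume "q ^ n = 1"
    have "poly.coeff (Polynomial.monom 1 n - 1 :: 'a poly) n = 1"
      using that by (simp add: coeff_1)
    hence "Polynomial.monom 1 n - 1 \<noteq> (0 :: 'a poly)" by (metis coeff_0 zero_neq_one)
    hence "algebraic q"
      by (intro algebraicI[of "Polynomial.monom 1 n - 1"])
        (auto simp: poly_monom \<open>q ^ n = 1\<close> coeff_diff coeff_1)
    thus False using assms by blast
  qed
  show "q \<noteq> 0" using assms by auto
qed

context
  fixes q :: "'k::field_char_0"
  assumes transcendental: "\<not> algebraic q"
begin

lemmas q = transcendental_neq(1)[OF transcendental]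
lemmas q0 = transcendental_neq(2)[OF transcendental]

lemma inv_x: "inv_into UNIV (sigma_x q) = lin_ext (\<lambda>m. Polynomial.monom (inverse (q ^ m)) m)"
  unfolding sigma_x_def by (rule inv_lin) (use q0 in auto)

lemma inv_y: "inv_into UNIV (sigma_y q) = lin_ext (\<lambda>m. Polynomial.monom (q ^ m) m)"
  unfolding sigma_y_def by (subst inv_lin) (use q0 in \<open>auto simp: power_int_minus\<close>)

lemma powi2: "q powi (-2) = inverse (q^2)" "q powi (-3) = inverse (q^3)" "q powi (- int m) = inverse (q ^ m)"
  "q powi (-(2 * int m)) = inverse (q ^ (2 * m))"
  apply (simp_all add: power_int_minus)
  by (metis of_nat_mult of_nat_numeral power_int_of_nat)

lemmas inv_x' = inv_x[unfolded sigma_x_def]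
lemmas inv_y' = inv_y[unfolded sigma_y_def powi2]

lemma plin_alpha: "plin (alpha_gen q g)"
  by (cases g) (auto simp: inv_x' sigma_x_def del_x_def intro!: plin_comps plin_lin_ext)

lemma plin_gamma: "plin (gamma_gen q g)"
  by (cases g) (auto simp: inv_y' powi2 sigma_y_def del_y_def intro!: plin_comps plin_lin_ext)

lemma nz: "q * q \<noteq> 1" "q ^ 2 \<noteq> 1" "q \<noteq> inverse q" "q^2 - 1 \<noteq> 0" "q - inverse q \<noteq> 0"
  using q[of 2] q0 by (auto simp: field_simps power2_eq_square)

lemma plin_diff: "plin f \<Longrightarrow> f (x - y) = f x - f y"
  by (metis plin_def add_diff_cancel_right' diff_add_cancel)


lemma plin_eval: "(\<And>g. plin (\<rho> g)) \<Longrightarrow> plin (free_eval \<rho> u)"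
  using plin_wev[of \<rho>]
  by (simp add: plin_def free_eval_super[OF finite_keys order_refl] smult_add_right sum.distrib smult_sum_right mult.commute)

lemma plin_sub0: "plin f \<Longrightarrow> f 0 = 0"
  unfolding plin_def by (metis smult_0_left)

lemma rel_split:
  assumes "\<And>g. plin (\<rho> g)"
    "\<And>m. \<rho> gK (\<rho> gKinv (Polynomial.monom 1 m)) = Polynomial.monom 1 m"
    "\<And>m. \<rho> gKinv (\<rho> gK (Polynomial.monom 1 m)) = Polynomial.monom 1 m"
    "\<And>m. \<rho> gK (\<rho> gE (\<rho> gKinv (Polynomial.monom 1 m))) = smult (q\<^sup>2) (\<rho> gE (Polynomial.monom 1 m))"
    "\<And>m. \<rho> gK (\<rho> gF (\<rho> gKinv (Polynomial.monom 1 m))) = smult (q powi (-2)) (\<rho> gF (Polynomial.monom 1 m))"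
    "\<And>m. \<rho> gE (\<rho> gF (Polynomial.monom 1 m)) - \<rho> gF (\<rho> gE (Polynomial.monom 1 m))
       = smult (1 / (q - inverse q)) (\<rho> gK (Polynomial.monom 1 m) - \<rho> gKinv (Polynomial.monom 1 m))"
    "u \<in> relators q"
  shows "free_eval \<rho> u = (\<lambda>_. 0)"
proof (rule plin_eqI)
  show "free_eval \<rho> u (Polynomial.monom 1 m) = 0" for m
    using assms(7) unfolding relators_def
    by (elim insertE emptyE)
       (simp_all add: free_eval_diff free_eval_mult[of \<rho>, OF assms(1)] free_eval_gen free_eval_1 free_eval_sc assms(2-6))
qed (use plin_eval assms(1) plin_comps in blast)+


lemma fp2: "f ^^ 2 = f \<circ> f" by (simp add: eval_nat_numeral)
lemma lin_ext_1: "lin_ext f 1 = f 0" by (simp add: lin_ext_def)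
lemma lin_ext_pc: "lin_ext f [:c:] = smult c (f 0)" by (simp add: lin_ext_def)
lemma lin_ext_0: "lin_ext f 0 = 0" by (simp add: lin_ext_def)


lemma coeff_identity: "inverse q * (q\<^sup>2 * (q ^ 4 - 1) * inverse q * inverse q) / (q\<^sup>2 - 1) =
   (q * q - inverse q * inverse q) / (q - inverse q)"
proof -
  have "q - inverse q = (q\<^sup>2 - 1) * inverse q" 
    "q * q - inverse q * inverse q = (q ^ 4 - 1) * inverse q * inverse q"
    using q0 by (simp_all add: field_simps power2_eq_square eval_nat_numeral)
  moreover have "q * (q * (inverse q * inverse q)) = 1" using q0 by (simp add: field_simps)
  ultimately show ?thesis using q0 nz(4) by (simp add: power2_eq_square)
qed

lemma alpha_rel: "u \<in> relators q \<Longrightarrow> free_eval (alpha_gen q) u = (\<lambda>_. 0)"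
proof (rule rel_split)
  fix m
  note d = sigma_x_def inv_x' del_x_def fp2 lin_ext_monom lin_ext_1 lin_ext_0 lin_ext_pc smult_monom mult_monom q0 powi2 minus_monom
  have sq: "q * q \<noteq> 1" "q * q - 1 \<noteq> 0" "q \<noteq> inverse q"
    using nz by (auto simp: power2_eq_square)
  have a: "q ^ n \<noteq> 0" for n using q0 by simp
  show "alpha_gen q gK (alpha_gen q gKinv (Polynomial.monom 1 m)) = Polynomial.monom 1 m"
   "alpha_gen q gKinv (alpha_gen q gK (Polynomial.monom 1 m)) = Polynomial.monom 1 m"
    by (simp_all add: d) (simp_all add: field_simps q0)
  show "alpha_gen q gK (alpha_gen q gE (alpha_gen q gKinv (Polynomial.monom 1 m))) = smult (q\<^sup>2) (alpha_gen q gE (Polynomial.monom 1 m))"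
    by (cases m; (simp add: d)?; (use sq a q0 in \<open>simp add: divide_simps power_even_eq\<close>)?; (simp add: power2_eq_square algebra_simps eval_nat_numeral)?)
  show "alpha_gen q gK (alpha_gen q gF (alpha_gen q gKinv (Polynomial.monom 1 m))) = smult (q powi (-2)) (alpha_gen q gF (Polynomial.monom 1 m))"
    by (cases m; (simp add: d)?; (use sq a q0 in \<open>simp add: divide_simps power_even_eq\<close>)?; (simp add: power2_eq_square algebra_simps eval_nat_numeral)?)
  show "alpha_gen q gE (alpha_gen q gF (Polynomial.monom 1 m)) - alpha_gen q gF (alpha_gen q gE (Polynomial.monom 1 m))
       = smult (1 / (q - inverse q)) (alpha_gen q gK (Polynomial.monom 1 m) - alpha_gen q gKinv (Polynomial.monom 1 m))"
    apply (cases m)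
    subgoal by (simp add: d diff_monom)
    subgoal for n
      apply (cases n)
      subgoal apply (simp add: d diff_monom) using coeff_identity nz(2) by argo
      subgoal for k
      apply (simp add: d diff_monom del: Polynomial.monom_eq_iff)
      apply (rule arg_cong[where f = "\<lambda>c. Polynomial.monom c _"])
      using sq a[of k] q0
   apply (simp add: divide_simps power_even_eq) by (intro conjI impI, simp add: power2_eq_square, simp add: power2_eq_square algebra_simps)
    done
    done
qed (auto intro: plin_alpha)

lemma gamma_rel: "u \<in> relators q \<Longrightarrow> free_eval (gamma_gen q) u = (\<lambda>_. 0)"
proof (rule rel_split)
  fix m
  note d = sigma_y_def inv_y' del_y_def fp2 lin_ext_monom lin_ext_1 lin_ext_0 lin_ext_pc smult_monom mult_monom q0 powi2 minus_monom
  have sq: "q * q \<noteq> 1" "q * q - 1 \<noteq> 0" "q \<noteq> inverse q"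
    using nz by (auto simp: power2_eq_square)
  have a: "q ^ n \<noteq> 0" for n using q0 by simp
  show "gamma_gen q gK (gamma_gen q gKinv (Polynomial.monom 1 m)) = Polynomial.monom 1 m"
   "gamma_gen q gKinv (gamma_gen q gK (Polynomial.monom 1 m)) = Polynomial.monom 1 m"
    by (simp_all add: d) (simp_all add: field_simps q0)
  show "gamma_gen q gK (gamma_gen q gE (gamma_gen q gKinv (Polynomial.monom 1 m))) = smult (q\<^sup>2) (gamma_gen q gE (Polynomial.monom 1 m))"
    by (cases m; (simp add: d)?; (use sq a q0 in \<open>simp add: divide_simps power_even_eq\<close>)?; (simp add: power2_eq_square algebra_simps eval_nat_numeral)?)
  show "gamma_gen q gK (gamma_gen q gF (gamma_gen q gKinv (Polynomial.monom 1 m))) = smult (q powi (-2)) (gamma_gen q gF (Polynomial.monom 1 m))"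
    by (cases m; (simp add: d)?; (use sq a q0 in \<open>simp add: divide_simps power_even_eq\<close>)?; (simp add: power2_eq_square algebra_simps eval_nat_numeral)?)
  show "gamma_gen q gE (gamma_gen q gF (Polynomial.monom 1 m)) - gamma_gen q gF (gamma_gen q gE (Polynomial.monom 1 m))
       = smult (1 / (q - inverse q)) (gamma_gen q gK (Polynomial.monom 1 m) - gamma_gen q gKinv (Polynomial.monom 1 m))"
    apply (cases m)
    subgoal by (simp add: d diff_monom)
    subgoal for n
      apply (cases n)
      subgoal apply (simp add: d diff_monom) using sq by (simp add: divide_simps power2_eq_square) (simp add: algebra_simps eval_nat_numeral)?
      subgoal for k
      apply (simp add: d diff_monom del: Polynomial.monom_eq_iff)
      apply (rule arg_cong[where f = "\<lambda>c. Polynomial.monom c _"])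
      using sq a[of k] q0
      by (simp add: divide_simps power_even_eq) (simp add: power2_eq_square algebra_simps eval_nat_numeral)
    done
    done
qed (auto intro: plin_gamma)

lemma alpha_coset: "alpha q (relation_ideal q +>\<^bsub>ring_of_type_algebra\<^esub> u) = free_eval (alpha_gen q) u"
  unfolding alpha_def by (simp add: eval_coset[OF plin_alpha alpha_rel])

lemma gamma_coset: "gamma q (relation_ideal q +>\<^bsub>ring_of_type_algebra\<^esub> u) = free_eval (gamma_gen q) u"
  unfolding gamma_def by (simp add: eval_coset[OF plin_gamma gamma_rel])

end

end

theory Submission
  imports Defs
begin

text \<open>The pair \<open>(\<sigma>, \<sigma>\<^sub>y)\<close> lies in \<open>\<Gamma>\<^sub>q\<close> but is not in the image of \<open>\<eta>\<close>; it is a square root of the pair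
  \<open>\<eta>(K) = (\<sigma>\<^sup>2, \<sigma>\<^sub>y\<^sup>2)\<close>. Both halves rest on the same observation: an operator of degree \<open>d\<close> is given by
  its coefficient sequence \<open>f\<close>, \<open>x\<^sup>n \<mapsto> f(n) x\<^bsup>n+d\<^esup>\<close>, and the operators in question have sequences that
  satisfy linear recurrences with known characteristic roots.

  Membership: \<open>\<sigma>\<close> and \<open>\<sigma>\<^sub>y\<close> are the automorphisms scaling the part of degree \<open>d\<close> by \<open>q\<^sup>d\<close>, which
  are q-differential operators of order zero on every graded algebra
  (\<open>grading_automorphism_diffop\<close>). The same automorphism of \<open>k[x, x\<inverse>]\<close> restricts to both. It is
  the canonical extension of both because a q-differential operator on \<open>k[x, x\<inverse>]\<close> is determined by
  its restriction to \<open>k[x]\<close> or to \<open>k[y]\<close> (\<open>M_ring_eqI\<close>): taking the bracket with \<open>x\<close> applies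
  \<open>f \<mapsto> f(n + 1) - q\<^sup>a f(n)\<close> to the coefficient sequences, so these satisfy recurrences with roots
  among the powers of \<open>q\<close> (\<open>diffops_upto_exp_poly\<close>), and such a sequence vanishes once it vanishes
  on a half-line.

  Failure of surjectivity: the generators of \<open>U\<^sub>q\<close> act on \<open>x\<^sup>n\<close> through \<open>q\<^bsup>2n\<^esup>\<close> and \<open>q\<^bsup>-2n\<^esup>\<close> only, so
  the coefficient sequences of \<open>\<alpha>(u)\<close> have characteristic roots among the even powers of \<open>q\<close>
  (\<open>exp_poly_free_eval_alpha\<close>). The sequence \<open>q\<^sup>n\<close> of \<open>\<sigma>\<close> has the root \<open>q\<close> instead, and since \<open>q\<close> is
  not a root of unity, \<open>q\<close> is not an even power of itself.\<close>

section \<open>Sequences with prescribed characteristic roots\<close>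

text \<open>With \<open>T\<close> the shift \<open>(T f) n = f (n + 1)\<close>, a function is in this class when some product of
  factors \<open>T - a\<close> with \<open>a \<in> A\<close>, repetitions allowed, annihilates it: for \<open>0 \<notin> A\<close>, functions on
  \<open>\<int>\<close> and characteristic 0, these are the exponential polynomials with bases in \<open>A\<close>. Peeling off one factor per rule
  matches the recursive definition of q-differential operators, in which each bracket with \<open>x\<close> acts
  on coefficient sequences as such a factor. The index type is left open: exponents are integers for
  Laurent polynomials and natural numbers for polynomials.\<close>
inductive exp_poly :: "'k::field set \<Rightarrow> ('a::comm_semiring_1 \<Rightarrow> 'k) \<Rightarrow> bool" for A where
  zero: "exp_poly A (\<lambda>_. 0)"
| step: "a \<in> A \<Longrightarrow> exp_poly A (\<lambda>n. f (n + 1) - a * f n) \<Longrightarrow> exp_poly A f"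

text \<open>All the factors \<open>T - b\<close> commute, so applying one more does not disturb the annihilating product.
  This is what makes the class closed under addition below, where the annihilators of the two
  summands have to be applied to both.\<close>
lemma exp_poly_difference: "exp_poly A f \<Longrightarrow> exp_poly A (\<lambda>n. f (n + 1) - b * f n)"
proof (induction rule: exp_poly.induct)
  case zero
  then show ?case by (simp add: exp_poly.zero)
next
  case (step a f)
  show ?case
    by (rule exp_poly.step[OF step.hyps(1)]) (use step.IH in \<open>simp add: algebra_simps\<close>)
qed

lemma exp_poly_add: "exp_poly A f \<Longrightarrow> exp_poly A g \<Longrightarrow> exp_poly A (\<lambda>n. f n + g n)"
proof (induction arbitrary: g rule: exp_poly.induct)
  case zero
  then show ?case by simp
next
  case (step a f)
  show ?case
    by (rule exp_poly.step[OF step.hyps(1)])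
      (use step.IH[OF exp_poly_difference[OF step.prems, of a]] in \<open>simp add: algebra_simps\<close>)
qed

lemma exp_poly_scale: "exp_poly A f \<Longrightarrow> exp_poly A (\<lambda>n. c * f n)"
proof (induction rule: exp_poly.induct)
  case zero
  then show ?case by (simp add: exp_poly.zero)
next
  case (step a f)
  show ?case
    by (rule exp_poly.step[OF step.hyps(1)]) (use step.IH in \<open>simp add: algebra_simps\<close>)
qed

lemma exp_poly_diff: "exp_poly A f \<Longrightarrow> exp_poly A g \<Longrightarrow> exp_poly A (\<lambda>n. f n - g n)"
  using exp_poly_add[of A f "\<lambda>n. - 1 * g n"] exp_poly_scale[of A g "- 1"] by simp

lemma exp_poly_shift: "exp_poly A f \<Longrightarrow> exp_poly A (\<lambda>n. f (n + k))"
proof (induction rule: exp_poly.induct)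
  case zero
  then show ?case by (simp add: exp_poly.zero)
next
  case (step a f)
  show ?case
    by (rule exp_poly.step[OF step.hyps(1)]) (use step.IH in \<open>simp add: add_ac\<close>)
qed

text \<open>Applied to the product of \<open>r\<^sup>n\<close> and \<open>f\<close>, the factor \<open>T - r a\<close> gives \<open>r\<^bsup>n+1\<^esup>\<close> times
  \<open>(T - a) f\<close>: multiplication by \<open>r\<^sup>n\<close> multiplies the characteristic roots by \<open>r\<close>.\<close>
lemma exp_poly_mult_power:
  fixes f :: "nat \<Rightarrow> 'k::field"
  assumes "exp_poly A f" "\<And>a. a \<in> A \<Longrightarrow> r * a \<in> A"
  shows "exp_poly A (\<lambda>n. r ^ n * f n)"
  using assms(1)
proof (induction rule: exp_poly.induct)
  case zero
  then show ?case by (simp add: exp_poly.zero)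
next
  case (step a f)
  have twisted: "exp_poly A (\<lambda>n. r * (r ^ n * (f (n + 1) - a * f n)))"
    using step.IH by (rule exp_poly_scale)
  show ?case
    by (rule exp_poly.step[OF assms(2)[OF step.hyps(1)]])
      (use twisted in \<open>simp add: algebra_simps\<close>)
qed

text \<open>A recurrence \<open>f (n + 1) = a f n\<close> with \<open>a \<noteq> 0\<close> can be run backwards, so the zeros spread
  from a right half-line to all integers, one factor at a time. In the next lemma they spread
  from a left half-line, for which the recurrence is run forwards.\<close>
lemma exp_poly_eq_0_if_eventually_0:
  fixes f :: "int \<Rightarrow> 'k::field"
  assumes "exp_poly A f" "0 \<notin> A" "\<And>n. n \<ge> N \<Longrightarrow> f n = 0"
  shows "f = (\<lambda>_. 0)"
  using assms(1,3)
proof (induction arbitrary: N rule: exp_poly.induct)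
  case (step a f)
  have "(\<lambda>n. f (n + 1) - a * f n) = (\<lambda>_. 0)"
    by (rule step.IH[of N]) (simp add: step.prems)
  then have rec: "f (n + 1) = a * f n" for n
    by (simp add: fun_eq_iff)
  have "f n = 0" for n
  proof (cases "n \<le> N")
    case True
    then show ?thesis
    proof (induction n rule: int_le_induct)
      case (step i)
      then show ?case using rec[of "i - 1"] \<open>a \<in> A\<close> \<open>0 \<notin> A\<close> by auto
    qed (simp add: step.prems)
  qed (simp add: step.prems)
  then show ?case by blast
qed simp

lemma exp_poly_eq_0_if_initially_0:
  fixes f :: "int \<Rightarrow> 'k::field"
  assumes "exp_poly A f" "\<And>n. n \<le> N \<Longrightarrow> f n = 0"
  shows "f = (\<lambda>_. 0)"
  using assms
proof (induction arbitrary: N rule: exp_poly.induct)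
  case (step a f)
  have "(\<lambda>n. f (n + 1) - a * f n) = (\<lambda>_. 0)"
    by (rule step.IH[of "N - 1"]) (simp add: step.prems)
  then have rec: "f (n + 1) = a * f n" for n
    by (simp add: fun_eq_iff)
  have "f n = 0" for n
  proof (cases "N \<le> n")
    case True
    then show ?thesis
      by (induction n rule: int_ge_induct) (simp_all add: step.prems rec)
  qed (simp add: step.prems)
  then show ?case by blast
qed simp

text \<open>The factor \<open>T - a\<close> multiplies the sequence \<open>b\<^sup>n\<close> by \<open>b - a\<close>, so no product of factors with
  \<open>a \<noteq> b\<close> can annihilate it.\<close>
lemma not_exp_poly_geometric:
  fixes c :: "'k::field"
  assumes "exp_poly A (\<lambda>n::nat. c * b ^ n)" "b \<notin> A"
  shows "c = 0"
proof -
  have "f = (\<lambda>n. c * b ^ n) \<Longrightarrow> c = 0" if "exp_poly A f" for f :: "nat \<Rightarrow> 'k" and c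
    using that
  proof (induction arbitrary: c rule: exp_poly.induct)
    case zero
    then show ?case by (metis power_0 mult_1_right)
  next
    case (step a f)
    have "(\<lambda>n. f (n + 1) - a * f n) = (\<lambda>n. (c * (b - a)) * b ^ n)"
      by (simp add: step.prems algebra_simps)
    then have "c * (b - a) = 0" by (rule step.IH)
    with \<open>a \<in> A\<close> \<open>b \<notin> A\<close> show ?case by auto
  qed
  then show ?thesis using assms(1) by blast
qed

section \<open>Homogeneous components and the bracket with multiplication operators\<close>

context graded_comm_algebra
begin

lemma linear_iff_additive_homogeneous:
  "Vector_Spaces.linear scale scale \<phi> \<longleftrightarrow>
    (\<forall>s t. \<phi> (s + t) = \<phi> s + \<phi> t) \<and> (\<forall>c s. \<phi> (scale c s) = scale c (\<phi> s))"
  using Vector_Spaces.linear_iff[of scale scale \<phi>] vector_space_axioms by simp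

lemma linear_on_sum:
  assumes "Vector_Spaces.linear scale scale \<phi>"
  shows "\<phi> (\<Sum>i\<in>I. f i) = (\<Sum>i\<in>I. \<phi> (f i))"
proof -
  have add: "\<phi> (s + t) = \<phi> s + \<phi> t" for s t
    using assms by (simp add: linear_iff_additive_homogeneous)
  then have "\<phi> 0 = 0" by (metis add_cancel_right_right)
  then show ?thesis
    by (induction I rule: infinite_finite_induct) (simp_all add: add)
qed

lemma scale_mult_right: "scale c (s * t) = s * scale c t"
  by (metis mult.commute scale_mult)

lemma homogeneous_0: "homogeneous d (\<lambda>_. 0)"
  by (auto simp: homogeneous_def linear_iff_additive_homogeneous subspace_0[OF subspace_G])

lemma homogeneous_add:
  "homogeneous d \<phi> \<Longrightarrow> homogeneous d \<psi> \<Longrightarrow> homogeneous d (\<lambda>s. \<phi> s + \<psi> s)"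
  by (auto simp: homogeneous_def linear_iff_additive_homogeneous algebra_simps
      image_subset_iff intro: subspace_add[OF subspace_G])

lemma homogeneous_compose:
  assumes "homogeneous d \<phi>" "homogeneous e \<psi>"
  shows "homogeneous (d + e) (\<phi> \<circ> \<psi>)"
proof -
  have "\<phi> (\<psi> s) \<in> G (b + (d + e))" if "s \<in> G b" for b s
  proof -
    have "\<phi> (\<psi> s) \<in> G ((b + e) + d)"
      using assms that by (simp add: homogeneous_def image_subset_iff)
    then show ?thesis by (simp add: ac_simps)
  qed
  then show ?thesis
    using assms by (auto simp: homogeneous_def linear_iff_additive_homogeneous)
qed

lemma homogeneous_mult: "s \<in> G d \<Longrightarrow> homogeneous d ((*) s)"
  using mult_G[of s d]
  by (auto simp: homogeneous_def linear_iff_additive_homogeneous scale_mult_right distrib_left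
      add.commute)

definition homogeneous_part :: "'s \<Rightarrow> int \<Rightarrow> 's" where
  "homogeneous_part s = (THE f. finite {b. f b \<noteq> 0} \<and> (\<forall>b. f b \<in> G b) \<and> s = (\<Sum>b | f b \<noteq> 0. f b))"

lemma homogeneous_part:
  "finite {b. homogeneous_part s b \<noteq> 0}" "homogeneous_part s b \<in> G b"
  "s = (\<Sum>b | homogeneous_part s b \<noteq> 0. homogeneous_part s b)"
proof -
  note part = theI'[OF direct_G[of s], folded homogeneous_part_def]
  show "finite {b. homogeneous_part s b \<noteq> 0}" "homogeneous_part s b \<in> G b"
    "s = (\<Sum>b | homogeneous_part s b \<noteq> 0. homogeneous_part s b)"
    by (rule conjunct1[OF part], rule spec[OF conjunct1[OF conjunct2[OF part]]],
        rule conjunct2[OF conjunct2[OF part]])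
qed

lemma homogeneous_part_unique:
  assumes "finite {b. f b \<noteq> 0}" "\<And>b. f b \<in> G b" "s = (\<Sum>b | f b \<noteq> 0. f b)"
  shows "f = homogeneous_part s"
  unfolding homogeneous_part_def using assms
  by (intro the1_equality[OF direct_G, symmetric] conjI allI)

lemma linear_eqI_on_homogeneous:
  assumes "Vector_Spaces.linear scale scale \<phi>" "Vector_Spaces.linear scale scale \<psi>"
    and "\<And>b s. s \<in> G b \<Longrightarrow> \<phi> s = \<psi> s"
  shows "\<phi> = \<psi>"
proof
  fix s
  show "\<phi> s = \<psi> s"
    using arg_cong[OF homogeneous_part(3)[of s], of \<phi>] arg_cong[OF homogeneous_part(3)[of s], of \<psi>]
    by (simp only: linear_on_sum[OF assms(1)] linear_on_sum[OF assms(2)] assms(3)[OF homogeneous_part(2)])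
qed

text \<open>For \<open>s\<close> of degree \<open>b\<close>, the value at \<open>s\<close> of the component of degree \<open>d\<close> has to be the part of
  \<open>\<psi> s\<close> of degree \<open>b + d\<close>, and the homogeneous elements span. Hence the description of
  \<^const>\<open>component\<close> picks out any decomposition that one can exhibit, such as the one of a
  multiplication operator into multiplications by homogeneous parts.\<close>
lemma hom_decomp_unique:
  assumes "hom_decomp f \<psi>" "hom_decomp g \<psi>"
  shows "f = g"
proof -
  have part: "h d s = homogeneous_part (\<psi> s) (b + d)" if h: "hom_decomp h \<psi>" and s: "s \<in> G b" for h b d s
  proof -
    let ?h = "\<lambda>e. h (e - b) s"
    let ?D = "{d. h d \<noteq> (\<lambda>_. 0)}"
    have D: "finite ?D" and hom: "homogeneous d (h d)" for d
      using h by (auto simp: hom_decomp_def)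
    have sub: "{e. ?h e \<noteq> 0} \<subseteq> (\<lambda>d. d + b) ` ?D"
    proof
      fix e assume "e \<in> {e. ?h e \<noteq> 0}"
      then show "e \<in> (\<lambda>d. d + b) ` ?D" by (intro image_eqI[of _ _ "e - b"]) auto
    qed
    have "?h = homogeneous_part (\<psi> s)"
    proof (rule homogeneous_part_unique)
      show "finite {e. ?h e \<noteq> 0}" using sub D by (auto intro: finite_subset)
      show "?h e \<in> G e" for e
        using hom[of "e - b"] s unfolding homogeneous_def by fastforce
      have "\<psi> s = (\<Sum>d\<in>?D. h d s)" using h by (simp add: hom_decomp_def)
      also have "\<dots> = (\<Sum>e\<in>(\<lambda>d. d + b) ` ?D. ?h e)"
        by (subst sum.reindex) auto
      also have "\<dots> = (\<Sum>e | ?h e \<noteq> 0. ?h e)"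
        by (rule sum.mono_neutral_right) (use sub D in auto)
      finally show "\<psi> s = (\<Sum>e | ?h e \<noteq> 0. ?h e)" .
    qed
    from fun_cong[OF this, of "b + d"] show ?thesis by simp
  qed
  show ?thesis
  proof
    fix d show "f d = g d"
    proof (rule linear_eqI_on_homogeneous)
      show "f d s = g d s" if "s \<in> G b" for b s
        using part[OF assms(1) that] part[OF assms(2) that] by simp
    qed (use assms in \<open>auto simp: hom_decomp_def homogeneous_def\<close>)
  qed
qed

lemma component_eq: "hom_decomp f \<psi> \<Longrightarrow> component \<psi> = f"
  unfolding component_def using hom_decomp_unique by (intro the_equality)

lemma mult_eq_0_iff_fun: "(*) s = (\<lambda>_. 0) \<longleftrightarrow> s = 0" for s :: 's
  by (metis mult.right_neutral mult_zero_left)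

lemma component_mult: "component ((*) s) d = (*) (homogeneous_part s d)"
proof -
  have "hom_decomp (\<lambda>d. (*) (homogeneous_part s d)) ((*) s)"
    unfolding hom_decomp_def mult_eq_0_iff_fun
    using homogeneous_part(1,2)[of s] homogeneous_mult
    by (auto simp: fun_eq_iff simp flip: sum_distrib_right homogeneous_part(3))
  from component_eq[OF this] show ?thesis by simp
qed

lemma twist_mult:
  "twist q a ((*) s) t =
    (\<Sum>d | homogeneous_part s d \<noteq> 0. scale (bichar q a d) (homogeneous_part s d)) * t"
  by (simp add: twist_def component_mult mult_eq_0_iff_fun sum_distrib_right scale_mult)

lemma homogeneous_part_homogeneous:
  assumes "s \<in> G b"
  shows "homogeneous_part s = (\<lambda>d. if d = b then s else 0)"
proof (rule sym, rule homogeneous_part_unique)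
  show "finite {d. (if d = b then s else 0) \<noteq> 0}"
    by (rule finite_subset[of _ "{b}"]) auto
  show "(if d = b then s else 0) \<in> G d" for d
    using assms subspace_0[OF subspace_G] by auto
  have "(\<Sum>d | (if d = b then s else 0) \<noteq> 0. if d = b then s else 0) = (\<Sum>d\<in>{b}. if d = b then s else 0)"
    by (rule sum.mono_neutral_left) auto
  then show "s = (\<Sum>d | (if d = b then s else 0) \<noteq> 0. if d = b then s else 0)" by simp
qed

lemma bracket_mult_homogeneous:
  assumes "s \<in> G d"
  shows "bracket q a \<phi> ((*) s) t = \<phi> (s * t) - scale (bichar q a d) s * \<phi> t"
proof -
  have "(\<Sum>e | homogeneous_part s e \<noteq> 0. scale (bichar q a e) (homogeneous_part s e))
      = (\<Sum>e\<in>{d}. scale (bichar q a e) (homogeneous_part s e))"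
    by (rule sum.mono_neutral_left) (auto simp: homogeneous_part_homogeneous[OF assms])
  then show ?thesis
    by (simp add: bracket_def twist_mult homogeneous_part_homogeneous[OF assms])
qed

lemma bimodule_gen_superset: "A \<subseteq> bimodule_gen A"
  by (auto simp: bimodule_gen_def)

lemma bimodule_gen_least: "subbimodule B \<Longrightarrow> A \<subseteq> B \<Longrightarrow> bimodule_gen A \<subseteq> B"
  by (auto simp: bimodule_gen_def)

lemma bimodule_gen_mult: "\<phi> \<in> bimodule_gen A \<Longrightarrow> (*) r \<circ> \<phi> \<in> bimodule_gen A"
  by (auto simp: bimodule_gen_def subbimodule_def)

text \<open>The operator that scales \<open>S\<^sub>d\<close> by \<open>q\<^sup>d\<close> is multiplicative, and on multiplication operators the
  twist with parameter 1 is exactly this scaling, \<open>\<sigma>\<^sub>1(s) = \<sigma> s\<close>. So \<open>\<sigma> s = \<sigma>\<^sub>1(s) \<sigma>\<close>, which says that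
  the bracket vanishes.\<close>
lemma grading_automorphism_diffop:
  assumes lin: "Vector_Spaces.linear scale scale \<sigma>"
    and \<sigma>: "\<And>d s. s \<in> G d \<Longrightarrow> \<sigma> s = scale (q powi d) s" and "q \<noteq> 0"
  shows "\<sigma> \<in> diffops_upto q 0"
proof -
  have hom: "\<sigma> (s * t) = \<sigma> s * \<sigma> t" if "s \<in> G d" "t \<in> G e" for d e s t
    using that \<open>q \<noteq> 0\<close>
    by (simp add: \<sigma>[OF that(1)] \<sigma>[OF that(2)] \<sigma>[OF mult_G[OF that]] power_int_add
        flip: scale_mult scale_mult_right)
  have hom_left: "\<sigma> (s * t) = \<sigma> s * \<sigma> t" if "s \<in> G d" for d s t
  proof -
    have "(\<lambda>t. \<sigma> (s * t)) = (\<lambda>t. \<sigma> s * \<sigma> t)"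
      using lin hom[OF that]
      by (intro linear_eqI_on_homogeneous)
        (auto simp: linear_iff_additive_homogeneous distrib_left simp flip: scale_mult_right)
    then show ?thesis by metis
  qed
  have "\<sigma> (s * t) = \<sigma> s * \<sigma> t" for s t
  proof -
    have "(\<lambda>s. \<sigma> (s * t)) = (\<lambda>s. \<sigma> s * \<sigma> t)"
      using lin hom_left
      by (intro linear_eqI_on_homogeneous)
        (auto simp: linear_iff_additive_homogeneous distrib_right simp flip: scale_mult)
    then show ?thesis by metis
  qed
  moreover have "(\<Sum>d | homogeneous_part s d \<noteq> 0. scale (bichar q 1 d) (homogeneous_part s d)) = \<sigma> s" for s
    using arg_cong[OF homogeneous_part(3)[of s], of \<sigma>]
    by (simp only: linear_on_sum[OF lin] \<sigma>[OF homogeneous_part(2)] bichar_def mult_1)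
  ultimately have "bracket q 1 \<sigma> ((*) s) = (\<lambda>_. 0)" for s
    by (simp add: bracket_def twist_mult)
  moreover have "homogeneous 0 \<sigma>"
    using lin \<sigma> subspace_scale[OF subspace_G] by (auto simp: homogeneous_def)
  ultimately show ?thesis
    unfolding diffops_upto.simps by (intro subsetD[OF bimodule_gen_superset]) blast
qed

section \<open>Closure properties of the graded endomorphisms\<close>

lemma homogeneous_in_grHom: "homogeneous d \<phi> \<Longrightarrow> \<phi> \<in> grHom"
proof -
  assume \<phi>: "homogeneous d \<phi>"
  let ?f = "\<lambda>e. if e = d then \<phi> else (\<lambda>_. 0)"
  have sub: "{e. ?f e \<noteq> (\<lambda>_. 0)} \<subseteq> {d}" by auto
  have "(\<Sum>e | ?f e \<noteq> (\<lambda>_. 0). ?f e s) = (\<Sum>e\<in>{d}. ?f e s)" for s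
    by (rule sum.mono_neutral_left) (use sub in auto)
  then have "hom_decomp ?f \<phi>"
    unfolding hom_decomp_def using \<phi> homogeneous_0 finite_subset[OF sub] by auto
  then show ?thesis by (auto simp: grHom_def)
qed

lemma grHom_0: "(\<lambda>_. 0) \<in> grHom"
  by (rule homogeneous_in_grHom[OF homogeneous_0])

lemma grHom_add:
  assumes "\<phi> \<in> grHom" "\<psi> \<in> grHom"
  shows "(\<lambda>s. \<phi> s + \<psi> s) \<in> grHom"
proof -
  obtain f g where fg: "hom_decomp f \<phi>" "hom_decomp g \<psi>" using assms by (auto simp: grHom_def)
  let ?D = "{d. f d \<noteq> (\<lambda>_. 0)} \<union> {d. g d \<noteq> (\<lambda>_. 0)}"
  let ?h = "\<lambda>d s. f d s + g d s"
  have D: "finite ?D" using fg by (auto simp: hom_decomp_def)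
  have sub: "{d. ?h d \<noteq> (\<lambda>_. 0)} \<subseteq> ?D" by auto
  have ext: "(\<Sum>d | h d \<noteq> (\<lambda>_. 0). h d s) = (\<Sum>d\<in>?D. h d s)"
    if "{d. h d \<noteq> (\<lambda>_. 0)} \<subseteq> ?D" for h :: "int \<Rightarrow> 's \<Rightarrow> 's" and s
    by (rule sum.mono_neutral_left) (use that D in auto)
  have "\<phi> s + \<psi> s = (\<Sum>d | ?h d \<noteq> (\<lambda>_. 0). ?h d s)" for s
  proof -
    have "\<phi> s = (\<Sum>d\<in>?D. f d s)" "\<psi> s = (\<Sum>d\<in>?D. g d s)"
      using fg by (auto simp: hom_decomp_def ext)
    then show ?thesis unfolding ext[OF sub] by (simp add: sum.distrib)
  qed
  then have "hom_decomp ?h (\<lambda>s. \<phi> s + \<psi> s)"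
    using fg D finite_subset[OF sub] homogeneous_add by (auto simp: hom_decomp_def)
  then show ?thesis by (auto simp: grHom_def)
qed

lemma grHom_sum: "(\<And>i. i \<in> I \<Longrightarrow> f i \<in> grHom) \<Longrightarrow> (\<lambda>s. \<Sum>i\<in>I. f i s) \<in> grHom"
  by (induction I rule: infinite_finite_induct) (auto simp: grHom_0 intro: grHom_add)

lemma grHom_linear:
  assumes "\<phi> \<in> grHom"
  shows "Vector_Spaces.linear scale scale \<phi>"
proof -
  obtain f where "hom_decomp f \<phi>" using assms by (auto simp: grHom_def)
  then have "\<phi> = (\<lambda>s. \<Sum>d | f d \<noteq> (\<lambda>_. 0). f d s)" "\<And>d. Vector_Spaces.linear scale scale (f d)"
    by (auto simp: hom_decomp_def homogeneous_def)
  then show ?thesis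
    by (auto simp: linear_iff_additive_homogeneous sum.distrib scale_sum_right)
qed

lemma grHom_compose:
  assumes "\<phi> \<in> grHom" "\<psi> \<in> grHom"
  shows "\<phi> \<circ> \<psi> \<in> grHom"
proof -
  obtain f g where fg: "hom_decomp f \<phi>" "hom_decomp g \<psi>" using assms by (auto simp: grHom_def)
  let ?D = "{d. f d \<noteq> (\<lambda>_. 0)}" and ?E = "{d. g d \<noteq> (\<lambda>_. 0)}"
  have "(\<phi> \<circ> \<psi>) s = (\<Sum>d\<in>?D. \<Sum>e\<in>?E. (f d \<circ> g e) s)" for s
  proof -
    have "f d (\<Sum>e\<in>?E. g e s) = (\<Sum>e\<in>?E. f d (g e s))" for d
      using fg linear_on_sum by (auto simp: hom_decomp_def homogeneous_def)
    then show ?thesis using fg by (simp add: hom_decomp_def)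
  qed
  then have eq: "\<phi> \<circ> \<psi> = (\<lambda>s. \<Sum>d\<in>?D. \<Sum>e\<in>?E. (f d \<circ> g e) s)" by blast
  have "f d \<circ> g e \<in> grHom" for d e
    using fg by (auto simp: hom_decomp_def intro!: homogeneous_in_grHom[OF homogeneous_compose])
  then show ?thesis unfolding eq by (intro grHom_sum)
qed

lemma grHom_mult: "(*) s \<in> grHom"
proof -
  have "(*) s = (\<lambda>t. \<Sum>b | homogeneous_part s b \<noteq> 0. homogeneous_part s b * t)"
    by (rule ext, subst (1) homogeneous_part(3)[of s]) (simp only: sum_distrib_right)
  then show ?thesis
    using grHom_sum[of "{b. homogeneous_part s b \<noteq> 0}" "\<lambda>b. (*) (homogeneous_part s b)"]
      homogeneous_in_grHom[OF homogeneous_mult[OF homogeneous_part(2)]] by simp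
qed

end

section \<open>Laurent operators are determined on half-lines of exponents\<close>

interpretation kx: graded_comm_algebra smult grading_x by (rule graded_x)
interpretation ky: graded_comm_algebra smult grading_y by (rule graded_y)
interpretation laurent: graded_comm_algebra scale_laurent grading_laurent by (rule graded_laurent)

lemma poly_mapping_additive_induct [case_names single add]:
  fixes f :: "'a \<Rightarrow>\<^sub>0 'b::comm_monoid_add"
  assumes "\<And>k v. P (Poly_Mapping.single k v)" "\<And>f g. P f \<Longrightarrow> P g \<Longrightarrow> P (f + g)"
  shows "P f"
proof (induction f rule: Poly_Mapping.update_induct)
  case const
  then show ?case using assms(1)[of undefined 0] by simp
next
  case (update f a b)
  have "Poly_Mapping.update a b f = f + Poly_Mapping.single a b"
    using update(1)
    by (intro poly_mapping_eqI)
      (auto simp: Poly_Mapping.lookup_update lookup_add lookup_single in_keys_iff when_def)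
  then show ?case using assms update by simp
qed

lemma lookup_single_mult:
  fixes f :: "'k::field laurent"
  shows "Poly_Mapping.lookup (Poly_Mapping.single j c * f) n = c * Poly_Mapping.lookup f (n - j)"
proof (induction f rule: poly_mapping_additive_induct)
  case (single k v)
  then show ?case by (auto simp: mult_single lookup_single when_def)
next
  case (add f g)
  then show ?case by (simp add: distrib_left lookup_add)
qed

lemma lookup_scale_laurent:
  "Poly_Mapping.lookup (scale_laurent c f) n = c * Poly_Mapping.lookup f n"
  by (simp add: scale_laurent_def lookup_single_mult)

text \<open>Indexing by the offset \<open>d\<close> from the diagonal makes \<open>n \<mapsto> matrix_entry \<phi> d n\<close> the coefficient
  sequence of the homogeneous component of \<open>\<phi>\<close> of degree \<open>d\<close>.\<close>
definition matrix_entry :: "('k::field laurent \<Rightarrow> 'k laurent) \<Rightarrow> int \<Rightarrow> int \<Rightarrow> 'k" where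
  "matrix_entry \<phi> d n = Poly_Mapping.lookup (\<phi> (Poly_Mapping.single n 1)) (n + d)"

definition exp_poly_operators :: "'k::field set \<Rightarrow> ('k laurent \<Rightarrow> 'k laurent) set" where
  "exp_poly_operators A = {\<phi> \<in> laurent.grHom. \<forall>d. exp_poly A (matrix_entry \<phi> d)}"

lemma matrix_entry_add: "matrix_entry (\<lambda>s. \<phi> s + \<psi> s) d = (\<lambda>n. matrix_entry \<phi> d n + matrix_entry \<psi> d n)"
  by (simp add: matrix_entry_def lookup_add fun_eq_iff)

lemma exp_poly_matrix_entry_mult_left:
  assumes "\<And>d. exp_poly A (matrix_entry \<phi> d)"
  shows "exp_poly A (matrix_entry ((*) r \<circ> \<phi>) d)"
proof (induction r rule: poly_mapping_additive_induct)
  case (single j c)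
  have "matrix_entry ((*) (Poly_Mapping.single j c) \<circ> \<phi>) d = (\<lambda>n. c * matrix_entry \<phi> (d - j) n)"
    by (simp add: matrix_entry_def lookup_single_mult fun_eq_iff add_diff_eq)
  then show ?case
    by (simp only:) (rule exp_poly_scale[OF assms])
next
  case (add f g)
  from exp_poly_add[OF add] show ?case
    by (simp add: matrix_entry_add o_def distrib_right flip: matrix_entry_add)
qed

lemma exp_poly_matrix_entry_mult_right:
  assumes \<phi>: "Vector_Spaces.linear scale_laurent scale_laurent \<phi>"
    and "\<And>d. exp_poly A (matrix_entry \<phi> d)"
  shows "exp_poly A (matrix_entry (\<phi> \<circ> (*) r) d)"
proof (induction r rule: poly_mapping_additive_induct)
  case (single j c)
  have "matrix_entry (\<phi> \<circ> (*) (Poly_Mapping.single j c)) d = (\<lambda>n. c * matrix_entry \<phi> (d - j) (n + j))"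
  proof
    fix n
    have "Poly_Mapping.single j c * Poly_Mapping.single n 1 = scale_laurent c (Poly_Mapping.single (n + j) 1)"
      by (simp add: scale_laurent_def mult_single add.commute)
    moreover have "\<phi> (scale_laurent c (Poly_Mapping.single (n + j) 1)) =
        scale_laurent c (\<phi> (Poly_Mapping.single (n + j) 1))"
      using \<phi> by (simp add: laurent.linear_iff_additive_homogeneous)
    ultimately show "matrix_entry (\<phi> \<circ> (*) (Poly_Mapping.single j c)) d n =
        c * matrix_entry \<phi> (d - j) (n + j)"
      by (simp add: matrix_entry_def lookup_scale_laurent)
  qed
  then show ?case
    by (simp only:) (rule exp_poly_scale[OF exp_poly_shift[OF assms(2)]])
next
  case (add f g)
  have "\<phi> \<circ> (*) (f + g) = (\<lambda>s. (\<phi> \<circ> (*) f) s + (\<phi> \<circ> (*) g) s)"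
    using \<phi> by (simp add: laurent.linear_iff_additive_homogeneous distrib_right fun_eq_iff)
  with exp_poly_add[OF add] show ?case
    by (simp only: matrix_entry_add)
qed

text \<open>Composing with a monomial on the left only moves the coefficient sequences to other degrees, and
  composing on the right also shifts the index. A general Laurent polynomial is a sum of monomials.\<close>
lemma subbimodule_exp_poly_operators: "laurent.subbimodule (exp_poly_operators A)"
  unfolding laurent.subbimodule_def
proof (intro conjI ballI allI)
  show "exp_poly_operators A \<subseteq> laurent.grHom"
    by (auto simp: exp_poly_operators_def)
  show "(\<lambda>_. 0) \<in> exp_poly_operators A"
    by (auto simp: exp_poly_operators_def laurent.grHom_0 matrix_entry_def[abs_def] exp_poly.zero)
next
  fix \<phi> \<psi> assume "\<phi> \<in> exp_poly_operators A" "\<psi> \<in> exp_poly_operators A"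
  then show "(\<lambda>s. \<phi> s + \<psi> s) \<in> exp_poly_operators A"
    by (simp add: exp_poly_operators_def laurent.grHom_add matrix_entry_add exp_poly_add)
next
  fix r :: "'a laurent" and \<phi> assume \<phi>: "\<phi> \<in> exp_poly_operators A"
  show "(*) r \<circ> \<phi> \<in> exp_poly_operators A"
    using \<phi> exp_poly_matrix_entry_mult_left[of A \<phi> r]
    by (simp add: exp_poly_operators_def laurent.grHom_compose laurent.grHom_mult)
  show "\<phi> \<circ> (*) r \<in> exp_poly_operators A"
    using \<phi> exp_poly_matrix_entry_mult_right[of \<phi> A r] laurent.grHom_linear[of \<phi>]
    by (simp add: exp_poly_operators_def laurent.grHom_compose laurent.grHom_mult)
qed

text \<open>The coefficient sequences of \<open>[\<phi>, x]\<^sub>a\<close> are those of \<open>\<phi>\<close> with the factor \<open>T - q\<^sup>a\<close> applied and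
  the degree raised by one. So bracketing with the single element \<open>x\<close> already controls \<open>\<phi>\<close>.\<close>
lemma exp_poly_operator_if_bracket:
  assumes "laurent.homogeneous d \<phi>"
    and "laurent.bracket q a \<phi> ((*) (Poly_Mapping.single 1 1)) \<in> exp_poly_operators (range ((powi) q))"
  shows "\<phi> \<in> exp_poly_operators (range ((powi) q))"
proof -
  let ?x = "Poly_Mapping.single 1 1 :: 'a laurent"
  have x: "?x \<in> grading_laurent 1" by (auto simp: grading_laurent_def)
  have scaled: "scale_laurent c ?x = Poly_Mapping.single 1 c" for c :: 'a
    by (simp add: scale_laurent_def mult_single)
  have "exp_poly (range ((powi) q)) (matrix_entry \<phi> e)" for e
  proof -
    have "matrix_entry (laurent.bracket q a \<phi> ((*) ?x)) (e + 1) =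
        (\<lambda>n. matrix_entry \<phi> e (n + 1) - q powi a * matrix_entry \<phi> e n)"
      by (simp add: fun_eq_iff matrix_entry_def laurent.bracket_mult_homogeneous[OF x] scaled
          lookup_minus lookup_single_mult mult_single bichar_def add.assoc add.commute[of 1])
    then have "exp_poly (range ((powi) q)) (\<lambda>n. matrix_entry \<phi> e (n + 1) - q powi a * matrix_entry \<phi> e n)"
      using assms(2) by (metis (mono_tags, lifting) exp_poly_operators_def mem_Collect_eq)
    then show ?thesis by (rule exp_poly.step[rotated]) simp
  qed
  with assms(1) show ?thesis
    by (auto simp: exp_poly_operators_def intro: laurent.homogeneous_in_grHom)
qed

lemma diffops_upto_exp_poly: "laurent.diffops_upto q l \<subseteq> exp_poly_operators (range ((powi) q))"
proof (induction l)
  case 0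
  have "(\<lambda>_. 0) \<in> exp_poly_operators (range ((powi) q))"
    using subbimodule_exp_poly_operators by (auto simp: laurent.subbimodule_def)
  then have "\<phi> \<in> exp_poly_operators (range ((powi) q))"
    if "laurent.homogeneous d \<phi>" "\<forall>s. laurent.bracket q a \<phi> ((*) s) = (\<lambda>_. 0)" for \<phi> d a
    using exp_poly_operator_if_bracket[OF that(1), of q a] that(2) by simp
  then show ?case
    unfolding laurent.diffops_upto.simps
    by (intro laurent.bimodule_gen_least subbimodule_exp_poly_operators) blast
next
  case (Suc l)
  then show ?case
    unfolding laurent.diffops_upto.simps
    by (intro laurent.bimodule_gen_least subbimodule_exp_poly_operators subsetI)
      (elim CollectE conjE exE, rule exp_poly_operator_if_bracket, blast+)
qed

lemma carrier_M_ring_exp_poly: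
  "\<phi> \<in> carrier (M_ring q) \<Longrightarrow> \<phi> \<in> exp_poly_operators (range ((powi) q))"
  using diffops_upto_exp_poly by (auto simp: M_ring_def laurent.diffops_def)

lemma linear_laurent_eqI:
  assumes "Vector_Spaces.linear scale_laurent scale_laurent \<phi>"
    "Vector_Spaces.linear scale_laurent scale_laurent \<psi>"
    "\<And>n. \<phi> (Poly_Mapping.single n 1) = \<psi> (Poly_Mapping.single n 1)"
  shows "\<phi> = (\<psi> :: 'a::field laurent \<Rightarrow> 'a laurent)"
proof (rule laurent.linear_eqI_on_homogeneous[OF assms(1,2)])
  fix b and s :: "'a laurent" assume "s \<in> grading_laurent b"
  then obtain c where "s = scale_laurent c (Poly_Mapping.single b 1)"
    by (auto simp: grading_laurent_def scale_laurent_def mult_single)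
  then show "\<phi> s = \<psi> s"
    using assms by (simp add: laurent.linear_iff_additive_homogeneous)
qed

text \<open>The injectivity of restriction to \<open>k[x]\<close>, and likewise to \<open>k[y]\<close>: the coefficient sequences of
  the difference of two operators have characteristic roots among the nonzero numbers \<open>q\<^sup>a\<close> and
  vanish on a half-line.\<close>
lemma M_ring_eqI:
  assumes "\<phi> \<in> carrier (M_ring q)" "\<psi> \<in> carrier (M_ring q)" and "q \<noteq> 0"
    and eq: "(\<forall>n \<ge> 0. \<phi> (Poly_Mapping.single n 1) = \<psi> (Poly_Mapping.single n 1)) \<or>
      (\<forall>n \<le> 0. \<phi> (Poly_Mapping.single n 1) = \<psi> (Poly_Mapping.single n 1))"
  shows "\<phi> = \<psi>"
proof (rule linear_laurent_eqI)
  note ops = assms(1,2)[THEN carrier_M_ring_exp_poly, unfolded exp_poly_operators_def]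
  show "Vector_Spaces.linear scale_laurent scale_laurent \<phi>"
    "Vector_Spaces.linear scale_laurent scale_laurent \<psi>"
    using ops laurent.grHom_linear by auto
  have zero: "(\<lambda>n. matrix_entry \<phi> d n - matrix_entry \<psi> d n) = (\<lambda>_. 0)" (is "?f = _") for d
  proof -
    have f: "exp_poly (range ((powi) q)) ?f"
      using ops by (intro exp_poly_diff) auto
    from eq show ?thesis
    proof
      assume "\<forall>n \<ge> 0. \<phi> (Poly_Mapping.single n 1) = \<psi> (Poly_Mapping.single n 1)"
      with \<open>q \<noteq> 0\<close> show ?thesis
        by (intro exp_poly_eq_0_if_eventually_0[OF f, of 0]) (auto simp: matrix_entry_def)
    next
      assume "\<forall>n \<le> 0. \<phi> (Poly_Mapping.single n 1) = \<psi> (Poly_Mapping.single n 1)"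
      then show ?thesis
        by (intro exp_poly_eq_0_if_initially_0[OF f, of 0]) (auto simp: matrix_entry_def)
    qed
  qed
  show "\<phi> (Poly_Mapping.single n 1) = \<psi> (Poly_Mapping.single n 1)" for n
  proof (rule poly_mapping_eqI)
    fix m
    show "Poly_Mapping.lookup (\<phi> (Poly_Mapping.single n 1)) m =
        Poly_Mapping.lookup (\<psi> (Poly_Mapping.single n 1)) m"
      using fun_cong[OF zero[of "m - n"], of n] by (simp add: matrix_entry_def)
  qed
qed

section \<open>A pair of grading automorphisms in \<open>\<Gamma>\<^sub>q\<close>\<close>

lemma lookup_embed_x:
  "Poly_Mapping.lookup (embed_x p) n = (if n \<ge> 0 then poly.coeff p (nat n) else 0)"
proof -
  have "Poly_Mapping.lookup (embed_x p) n =
      (\<Sum>i\<le>Polynomial.degree p. if i = nat n \<and> n \<ge> 0 then poly.coeff p i else 0)"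
    unfolding embed_x_def lookup_sum by (rule sum.cong) (auto simp: lookup_single when_def)
  also have "\<dots> = (if n \<ge> 0 then poly.coeff p (nat n) else 0)"
    by (cases "n \<ge> 0") (auto simp: coeff_eq_0)
  finally show ?thesis .
qed

lemma lookup_embed_y:
  "Poly_Mapping.lookup (embed_y p) n = (if n \<le> 0 then poly.coeff p (nat (- n)) else 0)"
proof -
  have "Poly_Mapping.lookup (embed_y p) n =
      (\<Sum>i\<le>Polynomial.degree p. if i = nat (- n) \<and> n \<le> 0 then poly.coeff p i else 0)"
    unfolding embed_y_def lookup_sum by (rule sum.cong) (auto simp: lookup_single when_def)
  also have "\<dots> = (if n \<le> 0 then poly.coeff p (nat (- n)) else 0)"
    by (cases "n \<le> 0") (auto simp: coeff_eq_0)
  finally show ?thesis .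
qed

lemma single_embed_x: "n \<ge> 0 \<Longrightarrow> Poly_Mapping.single n 1 = embed_x (Polynomial.monom 1 (nat n))"
  by (rule poly_mapping_eqI) (auto simp: lookup_embed_x lookup_single when_def)

lemma single_embed_y: "n \<le> 0 \<Longrightarrow> Poly_Mapping.single n 1 = embed_y (Polynomial.monom 1 (nat (- n)))"
  by (rule poly_mapping_eqI) (auto simp: lookup_embed_y lookup_single when_def)

lemma extend_x_eqI:
  assumes "q \<noteq> 0" "\<psi> \<in> carrier (M_ring q)" "\<And>p. \<psi> (embed_x p) = embed_x (\<phi> p)"
  shows "extend_x q \<phi> = \<psi>"
  unfolding extend_x_def
proof (rule the_equality)
  fix \<psi>' assume "\<psi>' \<in> carrier (M_ring q) \<and> (\<forall>p. \<psi>' (embed_x p) = embed_x (\<phi> p))"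
  then show "\<psi>' = \<psi>"
    using assms by (intro M_ring_eqI[of _ q]) (simp_all add: single_embed_x)
qed (use assms in auto)

lemma extend_y_eqI:
  assumes "q \<noteq> 0" "\<psi> \<in> carrier (M_ring q)" "\<And>p. \<psi> (embed_y p) = embed_y (\<phi> p)"
  shows "extend_y q \<phi> = \<psi>"
  unfolding extend_y_def
proof (rule the_equality)
  fix \<psi>' assume "\<psi>' \<in> carrier (M_ring q) \<and> (\<forall>p. \<psi>' (embed_y p) = embed_y (\<phi> p))"
  then show "\<psi>' = \<psi>"
    using assms by (intro M_ring_eqI[of _ q]) (simp_all add: single_embed_y)
qed (use assms in auto)

text \<open>The common extension of \<^const>\<open>sigma_x\<close> and \<^const>\<open>sigma_y\<close> to \<open>k[x, x\<inverse>]\<close>.\<close>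
definition sigma_laurent :: "'k::field \<Rightarrow> 'k laurent \<Rightarrow> 'k laurent" where
  "sigma_laurent q f = Poly_Mapping.Abs_poly_mapping (\<lambda>n. q powi n * Poly_Mapping.lookup f n)"

lemma lookup_sigma_laurent:
  "Poly_Mapping.lookup (sigma_laurent q f) n = q powi n * Poly_Mapping.lookup f n"
proof -
  have "finite {n. q powi n * Poly_Mapping.lookup f n \<noteq> 0}"
    by (rule finite_subset[of _ "{n. Poly_Mapping.lookup f n \<noteq> 0}"]) auto
  then show ?thesis by (simp add: sigma_laurent_def)
qed

lemma coeff_lin_ext_diagonal:
  "poly.coeff (lin_ext (\<lambda>m. Polynomial.monom (c m) m) p) n = c n * poly.coeff p n"
  by (simp add: lin_ext_def coeff_sum coeff_eq_0 not_le if_distrib cong: if_cong)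

lemma coeff_sigma_x: "poly.coeff (sigma_x q p) n = q ^ n * poly.coeff p n"
  by (simp add: sigma_x_def coeff_lin_ext_diagonal)

lemma coeff_sigma_y: "poly.coeff (sigma_y q p) n = q powi (- int n) * poly.coeff p n"
  by (simp add: sigma_y_def coeff_lin_ext_diagonal)

lemma sigma_x_D_ring: "q \<noteq> 0 \<Longrightarrow> sigma_x q \<in> carrier (D_ring q)"
proof -
  assume "q \<noteq> 0"
  have "sigma_x q \<in> kx.diffops_upto q 0"
  proof (rule kx.grading_automorphism_diffop[OF _ _ \<open>q \<noteq> 0\<close>])
    show "Vector_Spaces.linear smult smult (sigma_x q)"
      by (auto simp: kx.linear_iff_additive_homogeneous coeff_sigma_x algebra_simps intro!: poly_eqI)
    show "sigma_x q s = smult (q powi d) s" if "s \<in> grading_x d" for d s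
      using that by (auto simp: grading_x_def coeff_sigma_x power_int_def intro!: poly_eqI split: if_splits)
  qed
  then show ?thesis unfolding D_ring_def kx.diffops_def by (simp del: kx.diffops_upto.simps) blast
qed

lemma sigma_y_L_ring: "q \<noteq> 0 \<Longrightarrow> sigma_y q \<in> carrier (L_ring q)"
proof -
  assume "q \<noteq> 0"
  have "sigma_y q \<in> ky.diffops_upto q 0"
  proof (rule ky.grading_automorphism_diffop[OF _ _ \<open>q \<noteq> 0\<close>])
    show "Vector_Spaces.linear smult smult (sigma_y q)"
      by (auto simp: ky.linear_iff_additive_homogeneous coeff_sigma_y algebra_simps intro!: poly_eqI)
    show "sigma_y q s = smult (q powi d) s" if "s \<in> grading_y d" for d s
      using that by (auto simp: grading_y_def coeff_sigma_y intro!: poly_eqI split: if_splits)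
  qed
  then show ?thesis unfolding L_ring_def ky.diffops_def by (simp del: ky.diffops_upto.simps) blast
qed

lemma sigma_laurent_diffop: "q \<noteq> 0 \<Longrightarrow> sigma_laurent q \<in> laurent.diffops_upto q 0"
proof (rule laurent.grading_automorphism_diffop)
  show "Vector_Spaces.linear scale_laurent scale_laurent (sigma_laurent q)"
    by (auto simp: laurent.linear_iff_additive_homogeneous lookup_sigma_laurent lookup_add
        lookup_scale_laurent algebra_simps intro!: poly_mapping_eqI)
  show "sigma_laurent q s = scale_laurent (q powi d) s" if "s \<in> grading_laurent d" for d s
    using that by (auto simp: grading_laurent_def lookup_sigma_laurent lookup_scale_laurent
        lookup_single when_def intro!: poly_mapping_eqI)
qed

text \<open>Subtraction in a ring record is defined by a description of the additive inverse within the
  carrier. For \<open>\<sigma>\<close> the description is satisfied because \<open>- \<sigma>\<close> is again a q-differential operator,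
  being a left multiple of \<open>\<sigma>\<close>.\<close>
lemma sigma_laurent_M_ring:
  assumes "q \<noteq> 0"
  shows "sigma_laurent q \<in> carrier (M_ring q)" "sigma_laurent q \<ominus>\<^bsub>M_ring q\<^esub> sigma_laurent q = \<zero>\<^bsub>M_ring q\<^esub>"
proof -
  note \<sigma> = sigma_laurent_diffop[OF assms]
  show in_M: "sigma_laurent q \<in> carrier (M_ring q)"
    using \<sigma> unfolding M_ring_def laurent.diffops_def by (simp del: laurent.diffops_upto.simps) blast
  let ?m = "\<lambda>s. - sigma_laurent q s"
  have "(*) (- 1) \<circ> sigma_laurent q \<in> laurent.diffops_upto q 0"
    using \<sigma> unfolding laurent.diffops_upto.simps by (rule laurent.bimodule_gen_mult)
  then have "?m \<in> laurent.diffops_upto q 0" by (simp add: o_def del: laurent.diffops_upto.simps)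
  then have m: "?m \<in> carrier (M_ring q)"
    unfolding M_ring_def laurent.diffops_def by (simp del: laurent.diffops_upto.simps) blast
  have "\<ominus>\<^bsub>M_ring q\<^esub> sigma_laurent q = ?m"
    unfolding a_inv_def m_inv_def
    using m by (intro the_equality) (auto simp: M_ring_def laurent.diffops_def fun_eq_iff eq_neg_iff_add_eq_0)
  then show "sigma_laurent q \<ominus>\<^bsub>M_ring q\<^esub> sigma_laurent q = \<zero>\<^bsub>M_ring q\<^esub>"
    by (simp add: a_minus_def M_ring_def laurent.diffops_def)
qed

lemma sigma_in_Gamma_ring:
  assumes "q \<noteq> 0"
  shows "(sigma_x q, sigma_y q) \<in> carrier (Gamma_ring q)"
proof -
  have "extend_x q (sigma_x q) = sigma_laurent q"
    by (rule extend_x_eqI[OF assms sigma_laurent_M_ring(1)[OF assms]])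
      (rule poly_mapping_eqI, auto simp: lookup_sigma_laurent lookup_embed_x coeff_sigma_x power_int_def)
  moreover have "extend_y q (sigma_y q) = sigma_laurent q"
    by (rule extend_y_eqI[OF assms sigma_laurent_M_ring(1)[OF assms]])
      (rule poly_mapping_eqI, auto simp: lookup_sigma_laurent lookup_embed_y coeff_sigma_y)
  ultimately show ?thesis
    using sigma_x_D_ring[OF assms] sigma_y_L_ring[OF assms] sigma_laurent_M_ring(2)[OF assms]
    by (simp add: Gamma_ring_def a_kernel_def' RDirProd_carrier)
qed

section \<open>Coefficients of operators coming from \<open>U\<^sub>q\<close>\<close>

definition even_powers :: "'k::field \<Rightarrow> 'k set" where
  "even_powers q = range (\<lambda>i::int. q powi (2 * i))"

text \<open>The value 0 for negative \<open>n + d\<close> treats \<open>x\<^bsup>n+d\<^esup>\<close> with a negative exponent as zero, which lets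
  lowering operators be handled by the same formula in all degrees.\<close>
definition poly_matrix_entry :: "('k::field poly \<Rightarrow> 'k poly) \<Rightarrow> int \<Rightarrow> nat \<Rightarrow> 'k" where
  "poly_matrix_entry \<phi> d n =
    (if int n + d \<ge> 0 then poly.coeff (\<phi> (Polynomial.monom 1 n)) (nat (int n + d)) else 0)"

lemma exp_poly_mult_weight:
  fixes f :: "nat \<Rightarrow> 'k::field"
  assumes "exp_poly (even_powers q) f" "q \<noteq> 0"
  shows "exp_poly (even_powers q) (\<lambda>n. c * q powi (2 * i * (int n + d)) * f n)"
proof -
  have "exp_poly (even_powers q) (\<lambda>n. (q powi (2 * i)) ^ n * f n)"
  proof (rule exp_poly_mult_power[OF assms(1)])
    fix a assume "a \<in> even_powers q"
    then obtain j where "a = q powi (2 * j)" by (auto simp: even_powers_def)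
    then have "q powi (2 * i) * a = q powi (2 * (i + j))"
      using \<open>q \<noteq> 0\<close> by (simp add: power_int_add distrib_left)
    then show "q powi (2 * i) * a \<in> even_powers q"
      unfolding even_powers_def by (rule range_eqI)
  qed
  moreover have "q powi (2 * i * (int n + d)) = q powi (2 * i * d) * (q powi (2 * i)) ^ n" for n
  proof -
    have "(q powi (2 * i)) ^ n = q powi (2 * i * int n)"
      by (simp only: power_int_mult power_int_of_nat)
    then show ?thesis
      using \<open>q \<noteq> 0\<close> by (simp add: distrib_left power_int_add)
  qed
  ultimately show ?thesis
    using exp_poly_scale[of _ _ "c * q powi (2 * i * d)"] by (simp add: mult.assoc)
qed

text \<open>An operator that maps \<open>x\<^bsup>m\<^esup>\<close> to \<open>c x\<^bsup>m+s\<^esup>\<close>, where \<open>c\<close> is a combination of two even powers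
  \<open>q\<^bsup>2ik\<^esup>\<close> and \<open>q\<^bsup>2jk\<^esup>\<close> of the target exponent \<open>k = m + s\<close>, keeps the characteristic roots even powers
  of \<open>q\<close>. Two summands are what the generators of \<open>U\<^sub>q\<close> need. When the operator lowers degrees, that is
  for \<open>s < 0\<close>, the last hypothesis makes the formula for \<open>c\<close> vanish where a monomial would leave
  \<open>k[x]\<close>.\<close>
lemma exp_poly_entry_compose:
  fixes \<phi> :: "'k::field poly \<Rightarrow> 'k poly"
  assumes "q \<noteq> 0" and \<phi>: "\<And>d. exp_poly (even_powers q) (poly_matrix_entry \<phi> d)"
    and g: "\<And>p k. poly.coeff (g p) k = (u * q powi (2 * i * int k) + v * q powi (2 * j * int k)) *
      (if s \<le> int k then poly.coeff p (nat (int k - s)) else 0)"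
    and vanish: "\<And>k. s \<le> k \<Longrightarrow> k < 0 \<Longrightarrow> u * q powi (2 * i * k) + v * q powi (2 * j * k) = 0"
  shows "exp_poly (even_powers q) (poly_matrix_entry (g \<circ> \<phi>) d)"
proof -
  have "poly_matrix_entry (g \<circ> \<phi>) d =
    (\<lambda>n. u * q powi (2 * i * (int n + d)) * poly_matrix_entry \<phi> (d - s) n +
         v * q powi (2 * j * (int n + d)) * poly_matrix_entry \<phi> (d - s) n)"
  proof
    fix n
    let ?k = "int n + d"
    have "poly_matrix_entry (g \<circ> \<phi>) d n =
        (u * q powi (2 * i * ?k) + v * q powi (2 * j * ?k)) * poly_matrix_entry \<phi> (d - s) n"
    proof (cases "?k \<ge> 0")
      case True
      then show ?thesis by (simp add: poly_matrix_entry_def g algebra_simps)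
    next
      case False
      then show ?thesis using vanish[of ?k] by (auto simp: poly_matrix_entry_def)
    qed
    then show "poly_matrix_entry (g \<circ> \<phi>) d n =
       u * q powi (2 * i * ?k) * poly_matrix_entry \<phi> (d - s) n +
       v * q powi (2 * j * ?k) * poly_matrix_entry \<phi> (d - s) n"
      by (simp only: distrib_right)
  qed
  then show ?thesis
    by (simp only:) (intro exp_poly_add exp_poly_mult_weight \<phi> \<open>q \<noteq> 0\<close>)
qed

lemma coeff_del_x:
  "poly.coeff (del_x q p) k = (q ^ (2 * (k + 1)) - 1) / (q ^ 2 - 1) * poly.coeff p (k + 1)"
proof -
  have "poly.coeff (del_x q p) k = (\<Sum>m\<le>Polynomial.degree p.
      if m = k + 1 then (q ^ (2 * (k + 1)) - 1) / (q ^ 2 - 1) * poly.coeff p (k + 1) else 0)"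
    unfolding del_x_def lin_ext_def coeff_sum
  proof (rule sum.cong)
    fix m
    show "poly.coeff (smult (poly.coeff p m) (Polynomial.monom ((q ^ (2 * m) - 1) / (q\<^sup>2 - 1)) (m - 1))) k =
      (if m = k + 1 then (q ^ (2 * (k + 1)) - 1) / (q\<^sup>2 - 1) * poly.coeff p (k + 1) else 0)"
      by (cases m) auto
  qed simp
  then show ?thesis by (simp add: coeff_eq_0)
qed

context
  fixes q :: "'k::field_char_0"
  assumes transcendental: "\<not> algebraic q"
begin

lemmas q_nz = transcendental_neq(2)[OF transcendental]

lemma coeff_alpha_K: "poly.coeff (alpha_gen q gK p) k = q powi (2 * int k) * poly.coeff p k"
  by (simp add: fp2[OF transcendental] coeff_sigma_x power_int_mult power_even_eq power2_eq_square
      power_int_def nat_mult_distrib)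

lemma coeff_inv_sigma_sq:
  "poly.coeff ((inv_into UNIV (sigma_x q) ^^ 2) p) k = q powi (- 2 * int k) * poly.coeff p k"
proof -
  have "q powi (- 2 * int k) = inverse (q ^ k) * inverse (q ^ k)"
    using powi2(4)[OF transcendental, of k] by (simp add: power_even_eq power2_eq_square)
  then show ?thesis
    by (simp add: inv_x[OF transcendental] fp2[OF transcendental] coeff_lin_ext_diagonal)
qed

text \<open>The generators act on \<open>x\<^sup>m\<close> through \<open>q\<^bsup>2m\<^esup>\<close> and \<open>q\<^bsup>-2m\<^esup>\<close> only. They are composed on the left:
  composition on the right would shift the index \<open>n\<close> of the coefficient sequences, in the case of \<open>F\<close>
  to negative values.\<close>
lemma exp_poly_alpha_gen_compose:
  assumes "\<And>d. exp_poly (even_powers q) (poly_matrix_entry \<phi> d)"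
  shows "exp_poly (even_powers q) (poly_matrix_entry (alpha_gen q g \<circ> \<phi>) d)"
proof (cases g)
  case gK
  show ?thesis unfolding gK
    by (rule exp_poly_entry_compose[OF q_nz assms, where u = 1 and i = 1 and v = 0 and s = 0])
      (simp_all add: coeff_alpha_K del: alpha_gen.simps)
next
  case gKinv
  show ?thesis unfolding gKinv
    by (rule exp_poly_entry_compose[OF q_nz assms, where u = 1 and i = "- 1" and v = 0 and s = 0])
      (simp_all add: coeff_inv_sigma_sq)
next
  case gE
  show ?thesis unfolding gE
  \<comment> \<open>\<open>E\<close> maps \<open>x\<^bsup>k-1\<^esup>\<close> to \<open>- q\<^sup>2 (q\<^bsup>2(k-1)\<^esup> - 1) / (q\<^sup>2 - 1) x\<^sup>k\<close>, expanded by powers of \<open>q\<^sup>k\<close>\<close>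
  proof (rule exp_poly_entry_compose[OF q_nz assms,
        where u = "- 1 / (q\<^sup>2 - 1)" and i = 1 and v = "q\<^sup>2 / (q\<^sup>2 - 1)" and j = 0 and s = 1])
    fix p k
    show "poly.coeff (alpha_gen q gE p) k =
      (- 1 / (q\<^sup>2 - 1) * q powi (2 * 1 * int k) + q\<^sup>2 / (q\<^sup>2 - 1) * q powi (2 * 0 * int k)) *
      (if 1 \<le> int k then poly.coeff p (nat (int k - 1)) else 0)"
    \<comment> \<open>for \<open>k = 1\<close> both sides vanish because \<open>\<partial>\<close> kills constants, for \<open>k = 0\<close> because of the factor \<open>x\<^sup>2\<close>\<close>
    proof (cases "k < 2")
      case True
      then have "k = 0 \<or> k = 1" by auto
      then show ?thesis using q_nz by (auto simp: coeff_monom_mult)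
    next
      case False
      then obtain m where "k = m + 2" by (metis add.commute le_Suc_ex not_less)
      have "q powi (2 * int k) = q ^ (2 * (m + 1)) * q\<^sup>2"
        using q_nz by (simp add: \<open>k = m + 2\<close> power_int_add distrib_left power_int_def nat_mult_distrib
            nat_add_distrib power_add eval_nat_numeral)
      then have "- 1 / (q\<^sup>2 - 1) * q powi (2 * 1 * int k) + q\<^sup>2 / (q\<^sup>2 - 1) * q powi (2 * 0 * int k) =
          - (q\<^sup>2) * ((q ^ (2 * (m + 1)) - 1) / (q\<^sup>2 - 1))"
        by (simp add: diff_divide_distrib right_diff_distrib)
      moreover have "poly.coeff (alpha_gen q gE p) k =
          - (q\<^sup>2) * ((q ^ (2 * (m + 1)) - 1) / (q\<^sup>2 - 1)) * poly.coeff p (m + 1)"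
        by (simp add: \<open>k = m + 2\<close> coeff_monom_mult coeff_del_x)
      moreover have "1 \<le> int k" "nat (int k - 1) = m + 1"
        using \<open>k = m + 2\<close> by auto
      ultimately show ?thesis by (simp only: if_True)
    qed
  qed simp
next
  case gF
  show ?thesis unfolding gF
  \<comment> \<open>\<open>F\<close> maps \<open>x\<^bsup>k+1\<^esup>\<close> to \<open>q\<inverse> q\<^bsup>-2k\<^esup> (q\<^bsup>2(k+1)\<^esup> - 1) / (q\<^sup>2 - 1) x\<^sup>k\<close>, which vanishes at \<open>k = - 1\<close>\<close>
  proof (rule exp_poly_entry_compose[OF q_nz assms,
        where u = "q / (q\<^sup>2 - 1)" and i = 0 and v = "- inverse q / (q\<^sup>2 - 1)" and j = "- 1" and s = "- 1"])
    fix p k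
    have "q powi (2 * - 1 * int k) * q ^ (2 * k) = 1"
      using q_nz powi2(4)[OF transcendental, of k] by simp
    then have weights: "q powi (2 * - 1 * int k) * q ^ (2 * (k + 1)) = q * q"
      by (simp add: power_add power2_eq_square mult.assoc[symmetric])
    have distribute: "inverse q * t * ((r - 1) / c) = inverse q * (t * r) / c + - inverse q / c * t" for t r c
      by (simp add: diff_divide_distrib right_diff_distrib mult.assoc)
    have cancel: "inverse q * (q * q) = q"
      using q_nz by simp
    have "inverse q * q powi (2 * - 1 * int k) * ((q ^ (2 * (k + 1)) - 1) / (q\<^sup>2 - 1)) =
        q / (q\<^sup>2 - 1) + - inverse q / (q\<^sup>2 - 1) * q powi (2 * - 1 * int k)"
      by (simp only: distribute weights cancel)
    moreover have "poly.coeff (alpha_gen q gF p) k = inverse q * q powi (2 * - 1 * int k) *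
        ((q ^ (2 * (k + 1)) - 1) / (q\<^sup>2 - 1)) * poly.coeff p (k + 1)"
      by (simp add: coeff_inv_sigma_sq coeff_del_x)
    moreover have "- 1 \<le> int k" "nat (int k - - 1) = k + 1"
      by auto
    ultimately show "poly.coeff (alpha_gen q gF p) k =
      (q / (q\<^sup>2 - 1) * q powi (2 * 0 * int k) + - inverse q / (q\<^sup>2 - 1) * q powi (2 * - 1 * int k)) *
      (if - 1 \<le> int k then poly.coeff p (nat (int k - - 1)) else 0)"
      by (simp only: if_True) simp
  next
    fix k :: int assume "- 1 \<le> k" "k < 0"
    then have "k = - 1" by simp
    then show "q / (q\<^sup>2 - 1) * q powi (2 * 0 * k) + - inverse q / (q\<^sup>2 - 1) * q powi (2 * - 1 * k) = 0"
      using q_nz by (simp add: power2_eq_square)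
  qed
qed

lemma exp_poly_wev_alpha: "exp_poly (even_powers q) (poly_matrix_entry (wev (alpha_gen q) w) d)"
proof (induction w arbitrary: d)
  case Nil
  have "1 \<in> even_powers q" by (auto simp: even_powers_def intro: range_eqI[of _ _ 0])
  then have "exp_poly (even_powers q) (\<lambda>n::nat. 1)"
    by (rule exp_poly.step) (simp add: exp_poly.zero)
  moreover have "poly_matrix_entry (wev (alpha_gen q) []) d = (if d = 0 then (\<lambda>_. 1) else (\<lambda>_. 0))"
    by (auto simp: poly_matrix_entry_def wev_def fun_eq_iff)
  ultimately show ?case by (simp add: exp_poly.zero)
next
  case (Cons g w)
  have "wev (alpha_gen q) (g # w) = alpha_gen q g \<circ> wev (alpha_gen q) w"
    by (simp add: wev_def)
  then show ?case by (simp only:) (rule exp_poly_alpha_gen_compose[OF Cons.IH])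
qed

lemma exp_poly_free_eval_alpha:
  "exp_poly (even_powers q) (poly_matrix_entry (free_eval (alpha_gen q) u) d)"
proof -
  have "poly_matrix_entry (free_eval (alpha_gen q) u) d =
      (\<lambda>n. \<Sum>w\<in>Poly_Mapping.keys u. Poly_Mapping.lookup u w * poly_matrix_entry (wev (alpha_gen q) w) d n)"
    by (simp add: poly_matrix_entry_def fun_eq_iff coeff_sum free_eval_super[OF finite_keys order_refl])
  moreover have "exp_poly (even_powers q)
      (\<lambda>n. \<Sum>w\<in>W. Poly_Mapping.lookup u w * poly_matrix_entry (wev (alpha_gen q) w) d n)" for W
    by (induction W rule: infinite_finite_induct)
      (simp_all add: exp_poly.zero exp_poly_add exp_poly_scale exp_poly_wev_alpha)
  ultimately show ?thesis by simp
qed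

lemma not_even_power: "q \<notin> even_powers q"
proof
  assume "q \<in> even_powers q"
  then obtain i where i: "q = q powi (2 * i)" by (auto simp: even_powers_def)
  then have "q powi (2 * i - 1) = 1"
    using q_nz power_int_diff[of q "2 * i" 1] by simp
  then have "q ^ nat \<bar>2 * i - 1\<bar> = 1"
    by (auto simp: power_int_def abs_if power_inverse split: if_splits)
  moreover have "nat \<bar>2 * i - 1\<bar> > 0"
  proof -
    have "2 * i - 1 \<noteq> 0" by presburger
    then show ?thesis by simp
  qed
  ultimately show False using transcendental_neq(1)[OF transcendental] by blast
qed

text \<open>The diagonal coefficients of \<open>\<sigma>\<close> form the sequence \<open>q\<^sup>n\<close>, whose characteristic root \<open>q\<close> is not an
  even power of \<open>q\<close>.\<close>
lemma free_eval_alpha_neq_sigma_x: "free_eval (alpha_gen q) u \<noteq> sigma_x q"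
proof
  assume "free_eval (alpha_gen q) u = sigma_x q"
  then have "exp_poly (even_powers q) (poly_matrix_entry (sigma_x q) 0)"
    using exp_poly_free_eval_alpha[of u 0] by simp
  moreover have "poly_matrix_entry (sigma_x q) 0 = (\<lambda>n. 1 * q ^ n)"
    by (simp add: poly_matrix_entry_def coeff_sigma_x fun_eq_iff)
  ultimately have "exp_poly (even_powers q) (\<lambda>n. 1 * q ^ n)" by simp
  from not_exp_poly_geometric[OF this not_even_power] show False by simp
qed

end

theorem proposition5p2p1:
  fixes q :: "'k :: field_char_0"
  assumes "\<not> algebraic q"
  shows "\<not> carrier (Gamma_ring q) \<subseteq> eta q ` carrier (U_ring q)"
proof
  assume "carrier (Gamma_ring q) \<subseteq> eta q ` carrier (U_ring q)"
  then obtain U where U: "U \<in> carrier (U_ring q)" and "eta q U = (sigma_x q, sigma_y q)"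
    using sigma_in_Gamma_ring[OF transcendental_neq(2)[OF assms]] by force
  moreover from U obtain u where "U = relation_ideal q +>\<^bsub>ring_of_type_algebra\<^esub> u"
    by (auto simp: U_ring_def FactRing_def A_RCOSETS_def RCOSETS_def a_r_coset_def)
  ultimately have "free_eval (alpha_gen q) u = sigma_x q"
    by (simp add: eta_def alpha_coset[OF assms])
  then show False using free_eval_alpha_neq_sigma_x[OF assms] by blast
qed

end
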